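(* Let $X$ be a finite connected graph such that $\chi(X)\ne0$, and fix a voltage assignment $\alpha\colon\mathbf{E}_X\to\mathbb{Z}$ such that the graph $X_\infty := X(\mathbb{Z},\alpha)$ is connected. For every $n\in\mathbb{N}$ let $X_n := X(\mathbb{Z}/n\mathbb{Z},\pi_n\circ\alpha)$, where $\pi_n\colon\mathbb{Z}\to\mathbb{Z}/n\mathbb{Z}$ is the natural quotient map. Let $\mathcal{I}_\alpha\in\mathbb{Z}[t^{\pm1}]$ be the Ihara polynomial of $\alpha$, let $b := -\mathrm{ord}_{t=0}(\mathcal{I}_\alpha)\ge0$ and $e := \mathrm{ord}_{t=1}(\mathcal{I}_\alpha)\ge1$, and let $J_\alpha(t) := t^b(t-1)^{-e}\mathcal{I}_\alpha(t)\in\mathbb{Z}[t]$. Then the number of spanning trees of $X_n$ is $$\kappa(X_n)=(-1)^{b(n-1)}\cdot\kappa(X)\cdot n^{e-1}\cdot\frac{\Delta_n(J_\alpha)}{\Delta_1(J_\alpha)}$$ for every $n\in\mathbb{N}$, where $\{\Delta_n(J_\alpha)\}_{n\in\mathbb{N}}$ is the Pierce-Lehmer sequence associated to $J_\alpha$.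
   Context: $\mathbb{N}=\{1,2,\dots\}$. Graphs are in the sense of Serre: a graph $X$ consists of a set $V_X$ of vertices, a set $\mathbf{E}_X$ of directed edges, origin and terminus maps $o,t\colon\mathbf{E}_X\to V_X$, and an inversion $e\mapsto\bar e$ on $\mathbf{E}_X$ with $o(\bar e)=t(e)$, $t(\bar e)=o(e)$ and $\bar{\bar e}=e\ne\bar e$. Loops and multiple edges are allowed. $X$ is finite if $V_X$ and $\mathbf{E}_X$ are finite, and connected if any two vertices are joined by a path of directed edges. $\chi(X)=|V_X|-|\mathbf{E}_X|/2$, and $\kappa(X)$ is the number of spanning trees of a finite graph $X$. A voltage assignment with values in a group $G$ is a function $\alpha\colon\mathbf{E}_X\to G$ with $\alpha(\bar e)=\alpha(e)^{-1}$ for all $e$. The graph $X(G,\alpha)$ has vertex set $V_X\times G$, edge set $\mathbf{E}_X\times G$, and $o(e,\sigma)=(o(e),\sigma)$, $t(e,\sigma)=(t(e),\sigma\cdot\alpha(e))$, $\overline{(e,\sigma)}=(\bar e,\sigma\cdot\alpha(e))$. Ihara polynomial of $\alpha\colon\mathbf{E}_X\to\mathbb{Z}$: order $V_X=\{v_1,\dots,v_g\}$, let $D_X$ be the diagonal matrix with entries $\#\{e\in\mathbf{E}_X: o(e)=v_i\}$, and let $A_\alpha(t)$ be the $g\times g$ matrix with $(i,j)$ entry $\sum_{e:\,o(e)=v_i,\,t(e)=v_j}t^{\alpha(e)}$; then $\mathcal{I}_\alpha(t)=\det(D_X-A_\alpha(t))\in\mathbb{Z}[t^{\pm1}]$. $\mathrm{ord}_{t=a}$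 denotes the order of vanishing at $t=a$. For $f(t)=a_d\prod_{i=1}^d(t-\alpha_i)\in\mathbb{Z}[t]$ with $a_d\neq0$ and $\alpha_i\in\overline{\mathbb{Q}}$, the Pierce-Lehmer sequence is $\Delta_n(f)=a_d^n\prod_{i=1}^d(\alpha_i^n-1)=\mathrm{Res}(f(t),t^n-1)\in\mathbb{Z}$. *)

theory Defs
  imports
    "Graph_Theory.Graph_Theory"
    "Jordan_Normal_Form.Char_Poly"
    "HOL-Algebra.Elementary_Groups"
    "HOL-Library.Poly_Mapping"
    "HOL-Computational_Algebra.Fundamental_Theorem_Algebra"
begin

text \<open>
  A graph in the sense of Serre is a \<^locale>\<open>bidirected_digraph\<close>: a directed multigraph \<open>X\<close>
  together with a fixed-point free inversion \<open>r\<close> of its arcs that exchanges tail (origin) and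
  head (terminus).  That locale additionally normalises \<open>r\<close> to be the identity on values of the
  arc type that are not arcs of \<open>X\<close>.
  Connectedness (any two vertices are joined by a path of directed edges) is
  \<^const>\<open>strongly_connected\<close>.
\<close>

definition euler_char :: "('v, 'e) pre_digraph \<Rightarrow> rat" where
  "euler_char X = of_nat (card (verts X)) - of_nat (card (arcs X)) / 2"

text \<open>
  A circuit in the sense of Serre is a closed path of positive length without repeated vertices
  and without backtracking.  The last condition only matters in length two, where it excludes
  traversing an edge back and forth; loops and pairs of parallel edges do give circuits.
\<close>

definition circuit :: "('v, 'e) pre_digraph \<Rightarrow> ('e \<Rightarrow> 'e) \<Rightarrow> 'e list \<Rightarrow> bool" where
  "circuit X r p \<longleftrightarrow> pre_digraph.cycle X p \<and> successively (\<lambda>e e'. e' \<noteq> r e) p"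

text \<open>
  The constant \<open>spanning_tree\<close> of the graph library is not suitable here: it regards
  an edge followed by its inverse as a cycle.
\<close>

definition serre_spanning_tree ::
    "('v, 'e) pre_digraph \<Rightarrow> ('e \<Rightarrow> 'e) \<Rightarrow> ('v, 'e) pre_digraph \<Rightarrow> bool" where
  "serre_spanning_tree X r T \<longleftrightarrow>
     spanning T X \<and> r ` arcs T \<subseteq> arcs T \<and> strongly_connected T \<and> (\<nexists>p. circuit T r p)"

definition num_spanning_trees :: "('v, 'e) pre_digraph \<Rightarrow> ('e \<Rightarrow> 'e) \<Rightarrow> nat" where
  "num_spanning_trees X r = card {T. serre_spanning_tree X r T}"

definition voltage_assignment ::
    "('v, 'e) pre_digraph \<Rightarrow> ('e \<Rightarrow> 'e) \<Rightarrow> ('g, 'm) monoid_scheme \<Rightarrow> ('e \<Rightarrow> 'g) \<Rightarrow> bool" where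
  "voltage_assignment X r G \<alpha> \<longleftrightarrow>
     (\<forall>e \<in> arcs X. \<alpha> e \<in> carrier G \<and> \<alpha> (r e) = inv\<^bsub>G\<^esub> (\<alpha> e))"

definition derived_graph ::
    "('v, 'e) pre_digraph \<Rightarrow> ('g, 'm) monoid_scheme \<Rightarrow> ('e \<Rightarrow> 'g) \<Rightarrow> ('v \<times> 'g, 'e \<times> 'g) pre_digraph"
  where
  "derived_graph X G \<alpha> =
     \<lparr>verts = verts X \<times> carrier G, arcs = arcs X \<times> carrier G,
      tail = (\<lambda>(e, \<sigma>). (tail X e, \<sigma>)), head = (\<lambda>(e, \<sigma>). (head X e, \<sigma> \<otimes>\<^bsub>G\<^esub> \<alpha> e))\<rparr>"

definition derived_inversion ::
    "('v, 'e) pre_digraph \<Rightarrow> ('e \<Rightarrow> 'e) \<Rightarrow> ('g, 'm) monoid_scheme \<Rightarrow> ('e \<Rightarrow> 'g) \<Rightarrow> 'e \<times> 'g \<Rightarrow> 'e \<times> 'g"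
  where
  "derived_inversion X r G \<alpha> =
     (\<lambda>(e, \<sigma>). if e \<in> arcs X \<and> \<sigma> \<in> carrier G then (r e, \<sigma> \<otimes>\<^bsub>G\<^esub> \<alpha> e) else (e, \<sigma>))"

lemma bidirected_digraph_derived:
  assumes "bidirected_digraph X r" and "group G" and "voltage_assignment X r G \<alpha>"
  shows "bidirected_digraph (derived_graph X G \<alpha>) (derived_inversion X r G \<alpha>)"
proof -
  interpret X: bidirected_digraph X r by fact
  interpret G: group G by fact
  have \<alpha>: "\<alpha> e \<in> carrier G" "\<alpha> (r e) = inv\<^bsub>G\<^esub> (\<alpha> e)" if "e \<in> arcs X" for e
    using assms(3) that by (auto simp: voltage_assignment_def)
  show ?thesis
    by unfold_locales
      (auto simp: derived_graph_def derived_inversion_def \<alpha> G.m_assoc X.arev_neq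
        split: if_splits)
qed

text \<open>
  The ring \<open>\<int>[t, t\<inverse>]\<close> of Laurent polynomials is the group ring of the additive group of
  integers, i.e. finitely supported functions with the convolution product.
\<close>

type_synonym laurent_poly = "int \<Rightarrow>\<^sub>0 int"

definition lp_power :: "int \<Rightarrow> laurent_poly" where
  "lp_power k = Poly_Mapping.single k 1"

definition lp_of_poly :: "int poly \<Rightarrow> laurent_poly" where
  "lp_of_poly p = poly (map_poly of_int p) (lp_power 1)"

text \<open>
  Order of vanishing at \<open>a\<close> of a nonzero Laurent polynomial, computed as that of the rational
  function \<open>P / t ^ N\<close> for any representation of this form.
\<close>

definition lp_order :: "int \<Rightarrow> laurent_poly \<Rightarrow> int" where
  "lp_order a f = (THE m. \<forall>N P. lp_power (int N) * f = lp_of_poly P \<longrightarrow>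
      m = int (Polynomial.order a P) - int (Polynomial.order a (monom 1 N)))"

lemma lp_power_add: "lp_power (k + l) = lp_power k * lp_power l"
  by (simp add: lp_power_def mult_single)

lemma lp_power_of_nat: "lp_power (int n) = lp_power 1 ^ n"
  by (induction n) (simp_all add: lp_power_add, simp add: lp_power_def)

lemma lp_of_poly_mult: "lp_of_poly (p * q) = lp_of_poly p * lp_of_poly q"
  by (simp add: lp_of_poly_def of_int_poly_hom.hom_mult)

lemma lp_of_poly_monom: "lp_of_poly (monom 1 n) = lp_power (int n)"
  by (simp add: lp_of_poly_def map_poly_monom poly_monom lp_power_of_nat)

lemma lookup_of_int_mult_lp_power:
  "Poly_Mapping.lookup (of_int c * lp_power k) l = (if l = k then c else 0)"
proof -
  have "(of_int c :: laurent_poly) = Poly_Mapping.single 0 c"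
    by (metis of_int_eq_id id_apply single_of_int)
  then show ?thesis
    by (simp add: lp_power_def mult_single lookup_single when_def)
qed

lemma lookup_lp_of_poly: "Poly_Mapping.lookup (lp_of_poly p) (int i) = coeff p i"
proof -
  have "lp_of_poly p = (\<Sum>j\<le>degree p. of_int (coeff p j) * lp_power (int j))"
    by (simp add: lp_of_poly_def poly_altdef lp_power_of_nat degree_map_poly coeff_map_poly)
  then show ?thesis
    by (simp add: lookup_sum lookup_of_int_mult_lp_power coeff_eq_0)
qed

lemma lp_of_poly_inject: "lp_of_poly p = lp_of_poly q \<longleftrightarrow> p = q"
  by (metis lookup_lp_of_poly poly_eqI)

lemma lp_order_eq:
  assumes "f \<noteq> 0" and P: "lp_power (int N) * f = lp_of_poly P"
  shows "lp_order a f = int (Polynomial.order a P) - int (Polynomial.order a (monom 1 N))"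
proof -
  have nz: "Q \<noteq> 0" if "lp_power (int M) * f = lp_of_poly Q" for M Q
  proof
    assume "Q = 0"
    then have "lp_power (int M) * f = 0" using that by (simp add: lp_of_poly_def)
    then have "lp_power (- int M) * (lp_power (int M) * f) = 0" by simp
    then have "lp_power 0 * f = 0"
      by (metis add.left_inverse lp_power_add mult.assoc)
    then show False using assms(1) by (simp add: lp_power_def)
  qed
  have uniq: "int (Polynomial.order a P) - int (Polynomial.order a (monom 1 N)) =
      int (Polynomial.order a Q) - int (Polynomial.order a (monom 1 M))"
    if Q: "lp_power (int M) * f = lp_of_poly Q" for M Q
  proof -
    have "lp_of_poly (monom 1 M * P) = lp_of_poly (monom 1 N * Q)"
      by (simp only: lp_of_poly_mult lp_of_poly_monom P [symmetric] Q [symmetric] mult.left_commute)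
    then have eq: "monom 1 M * P = monom 1 N * Q"
      by (simp only: lp_of_poly_inject)
    have "Polynomial.order a (monom 1 M * P) =
        Polynomial.order a (monom 1 M) + Polynomial.order a P"
      using nz [OF P] by (intro order_mult) (simp add: monom_eq_0_iff)
    moreover have "Polynomial.order a (monom 1 N * Q) =
        Polynomial.order a (monom 1 N) + Polynomial.order a Q"
      using nz [OF Q] by (intro order_mult) (simp add: monom_eq_0_iff)
    ultimately show ?thesis using eq by simp
  qed
  show ?thesis
    unfolding lp_order_def
  proof (rule the_equality)
    fix m
    assume "\<forall>N P. lp_power (int N) * f = lp_of_poly P \<longrightarrow>
      m = int (Polynomial.order a P) - int (Polynomial.order a (monom 1 N))"
    with P show "m = int (Polynomial.order a P) - int (Polynomial.order a (monom 1 N))"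
      by blast
  qed (use uniq in blast)
qed

definition ihara_matrix ::
    "('v, 'e) pre_digraph \<Rightarrow> ('e \<Rightarrow> int) \<Rightarrow> 'v list \<Rightarrow> laurent_poly mat" where
  "ihara_matrix X \<alpha> vs = mat (length vs) (length vs) (\<lambda>(i, j).
     (if i = j then of_nat (card {e \<in> arcs X. tail X e = vs ! i}) else 0) -
     (\<Sum>e | e \<in> arcs X \<and> tail X e = vs ! i \<and> head X e = vs ! j. lp_power (\<alpha> e)))"

text \<open>The list \<open>vs\<close> is an ordering of the vertices, without repetitions.\<close>

definition ihara_poly ::
    "('v, 'e) pre_digraph \<Rightarrow> ('e \<Rightarrow> int) \<Rightarrow> 'v list \<Rightarrow> laurent_poly" where
  "ihara_poly X \<alpha> vs = Determinant.det (ihara_matrix X \<alpha> vs)"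

text \<open>
  The roots are taken in the complex numbers, with multiplicities; the value is an integer.
\<close>

definition pierce_lehmer :: "int poly \<Rightarrow> nat \<Rightarrow> complex" where
  "pierce_lehmer f n =
     of_int (lead_coeff f) ^ n * (\<Prod>z \<in># proots (map_poly of_int f). z ^ n - 1)"

end

theory Submission
  imports Defs
begin

text \<open>
  By the matrix-tree theorem, the linear coefficient of the characteristic polynomial of the
  Laplacian of a graph \<open>Y\<close> is, up to sign, \<open>\<bar>V\<^sub>Y\<bar> \<kappa>(Y)\<close>.  The Laplacian of \<open>X\<^sub>n\<close> is block circulant, hence
  similar to the block diagonal matrix with blocks \<open>D - A(\<zeta>)\<close>, \<open>\<zeta>\<^sup>n = 1\<close>.  Comparing linear
  coefficients gives \<open>n \<kappa>(X\<^sub>n) = \<kappa>(X) \<Prod> I(\<zeta>)\<close>, the product being over the \<open>n\<close>-th roots of unity \<open>\<zeta> \<noteq> 1\<close>.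
  Now substitute \<open>I(t) = (t - 1)\<^sup>e J(t) / t\<^sup>b\<close>; the signs are sorted out by the symmetry \<open>I(1/t) = I(t)\<close>,
  which forces \<open>deg J = 2 b - e\<close>.
\<close>

subsection \<open>Spanning trees and arborescences\<close>

text \<open>Determinants alone say nothing about trees here: constant functions lie in the kernel of
  every Laplacian. In the product of the characteristic polynomials of the blocks, the block at zeta
  = 1 has zero constant term, so it contributes its linear coefficient, hence kappa(X), while every
  other block contributes its constant term, hence I(zeta). The numbers b and e make sense only if I
  is not zero. This is where connectedness of the infinite cover enters: it makes D - A(-1)
  nonsingular. The value -1 is chosen because its powers are real and square to 1, which turns the
  associated quadratic form into a sum of squares. For the signs, the nontrivial n-th roots of unity
  satisfy prod zeta = (-1)^(n-1) and prod (zeta - 1) = (-1)^(n-1) n, and replacing prod J(zeta) by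
  the Pierce-Lehmer ratio costs (-1)^((n-1) deg J). The exponents add up to b + e + deg J = 3 b,
  which has the parity of b. The e factors n, less the one that multiplies kappa(X_n), leave
  n^(e-1).\<close>

context wf_digraph
begin

text \<open>
  The rank \<open>d\<close> certifies that following the chosen arcs from any vertex ends in the root \<open>s\<close>.
\<close>

definition arborescences :: "'a \<Rightarrow> ('a \<Rightarrow> 'b) set" where
  "arborescences s = {f \<in> \<Pi>\<^sub>E v\<in>verts G - {s}. out_arcs G v.
     \<exists>d::'a \<Rightarrow> nat. \<forall>v\<in>verts G - {s}. d (head G (f v)) < d v}"

lemma arborescences_arc:
  assumes "f \<in> arborescences s" and "v \<in> verts G - {s}"
  shows "f v \<in> arcs G" and "tail G (f v) = v"
  using assms by (auto simp: arborescences_def PiE_iff)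

end

section \<open>Spanning trees as root-directed arborescences\<close>

context bidirected_digraph
begin

definition arborescence_tree :: "'a \<Rightarrow> ('a \<Rightarrow> 'b) \<Rightarrow> ('a, 'b) pre_digraph" where
  "arborescence_tree s f = G\<lparr>arcs := f ` (verts G - {s}) \<union> arev ` f ` (verts G - {s})\<rparr>"

lemma arborescence_tree_simps [simp]:
  "verts (arborescence_tree s f) = verts G"
  "tail (arborescence_tree s f) = tail G"
  "head (arborescence_tree s f) = head G"
  "arcs (arborescence_tree s f) = f ` (verts G - {s}) \<union> arev ` f ` (verts G - {s})"
  by (simp_all add: arborescence_tree_def)

lemma bidirected_subgraph:
  assumes "arcs T \<subseteq> arcs G" "verts T = verts G" "tail T = tail G" "head T = head G"
    "arev ` arcs T \<subseteq> arcs T"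
  shows "wf_digraph T" "symmetric T" "spanning T G"
proof -
  show wf: "wf_digraph T"
    using assms wellformed by unfold_locales auto
  show "spanning T G"
    using assms wf wf_digraph by (auto simp: spanning_def subgraph_def compatible_def)
  show "symmetric T"
    unfolding symmetric_def
  proof (rule symI)
    fix u v
    assume "u \<rightarrow>\<^bsub>T\<^esub> v"
    then obtain e where e: "e \<in> arcs T" "tail G e = u" "head G e = v"
      using assms by auto
    with assms have "arev e \<in> arcs T" "tail G (arev e) = v" "head G (arev e) = u"
      by auto
    then show "v \<rightarrow>\<^bsub>T\<^esub> u"
      using assms by (auto simp: arcs_ends_def arc_to_ends_def image_iff intro!: bexI[of _ "arev e"])
  qed
qed

lemma arborescence_tree_subgraph:
  assumes f: "f \<in> arborescences s"
  shows "arev ` arcs (arborescence_tree s f) \<subseteq> arcs (arborescence_tree s f)"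
    "arcs (arborescence_tree s f) \<subseteq> arcs G"
    "wf_digraph (arborescence_tree s f)" "symmetric (arborescence_tree s f)"
    "spanning (arborescence_tree s f) G"
proof -
  show inv: "arev ` arcs (arborescence_tree s f) \<subseteq> arcs (arborescence_tree s f)"
    by (auto simp: image_iff)
  show sub: "arcs (arborescence_tree s f) \<subseteq> arcs G"
  proof
    fix e
    assume "e \<in> arcs (arborescence_tree s f)"
    then obtain v where "v \<in> verts G - {s}" "e = f v \<or> e = arev (f v)" by auto
    then show "e \<in> arcs G" using arborescences_arc(1)[OF f, of v] by auto
  qed
  show "wf_digraph (arborescence_tree s f)" "symmetric (arborescence_tree s f)"
    "spanning (arborescence_tree s f) G"
    using bidirected_subgraph[OF sub _ _ _ inv] by simp_all
qed

lemma reachable_arborescence_tree: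
  assumes f: "f \<in> arborescences s" and s: "s \<in> verts G" and v: "v \<in> verts G"
  shows "v \<rightarrow>\<^sup>*\<^bsub>arborescence_tree s f\<^esub> s"
proof -
  let ?T = "arborescence_tree s f"
  interpret T: wf_digraph ?T
    by (rule arborescence_tree_subgraph(3)[OF f])
  obtain d :: "'a \<Rightarrow> nat" where d: "\<forall>v\<in>verts G - {s}. d (head G (f v)) < d v"
    using f by (auto simp: arborescences_def)
  show ?thesis using v
  proof (induction "d v" arbitrary: v rule: less_induct)
    case less
    show ?case
    proof (cases "v = s")
      case False
      then have fv: "f v \<in> arcs G" "tail G (f v) = v" "f v \<in> arcs ?T"
        using arborescences_arc[OF f, of v] less.prems by auto
      then have "v \<rightarrow>\<^bsub>?T\<^esub> head G (f v)"
        using T.in_arcs_imp_in_arcs_ends[of "f v"] by simp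
      moreover have "head G (f v) \<rightarrow>\<^sup>*\<^bsub>?T\<^esub> s"
        using less d fv(1) False by auto
      ultimately show ?thesis
        using T.adj_reachable_trans by blast
    qed (use s in auto)
  qed
qed

lemma strongly_connected_arborescence_tree:
  assumes f: "f \<in> arborescences s" and s: "s \<in> verts G"
  shows "strongly_connected (arborescence_tree s f)"
proof -
  let ?T = "arborescence_tree s f"
  have T: "wf_digraph ?T" "symmetric ?T"
    by (rule arborescence_tree_subgraph[OF f])+
  interpret T: wf_digraph ?T by fact
  have "u \<rightarrow>\<^sup>*\<^bsub>?T\<^esub> v" if "u \<in> verts G" "v \<in> verts G" for u v
    using reachable_arborescence_tree[OF f s that(1)]
      symmetric_reachable[OF T(2) reachable_arborescence_tree[OF f s that(2)]]
      T.reachable_trans by blast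
  then show ?thesis
    using s by (auto simp: strongly_connected_def)
qed

text \<open>
  At a vertex of maximal rank on a circuit of the tree, the outgoing arc must be the arc of \<open>f\<close>
  and the incoming one its inverse.
\<close>

lemma no_circuit_arborescence_tree:
  assumes f: "f \<in> arborescences s" and s: "s \<in> verts G"
  shows "\<not> circuit (arborescence_tree s f) arev p"
proof
  let ?T = "arborescence_tree s f"
  interpret T: wf_digraph ?T
    by (rule arborescence_tree_subgraph(3)[OF f])
  assume "circuit ?T arev p"
  then obtain u where u: "T.awalk u p u" "distinct (tl (T.awalk_verts u p))" "p \<noteq> []"
    and nb: "successively (\<lambda>e e'. e' \<noteq> arev e) p"
    by (auto simp: circuit_def T.cycle_def)
  have p: "set p \<subseteq> arcs ?T" and cas: "T.cas u p u"
    using u(1) by (auto simp: T.awalk_def)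
  have pG: "set p \<subseteq> arcs G"
    using p arborescence_tree_subgraph(2)[OF f] by blast
  obtain d :: "'a \<Rightarrow> nat" where d: "\<forall>v\<in>verts G - {s}. d (head G (f v)) < d v"
    using f by (auto simp: arborescences_def)
  define k where "k = length p"
  have k: "k > 0" using u(3) by (simp add: k_def)
  have dist: "distinct (map (head G) p)"
    using u(2) T.awalk_verts_conv'[OF cas] u(3) by simp
  have verts_eq: "map (tail G) p @ [head G (last p)] = tail G (hd p) # map (head G) p"
    using T.awalk_verts_conv'[OF cas] T.awalk_verts_conv[of u p] u(3) by simp
  have step: "head G (p ! i) = tail G (p ! Suc i)" if "Suc i < k" for i
    using arg_cong[OF verts_eq, of "\<lambda>xs. xs ! Suc i"] that by (simp add: nth_append k_def)
  have "T.awlast u p = u" using u(1) by (metis T.awalkE)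
  moreover have "T.awhd u p = u" using u(1) by (metis T.awalkE)
  ultimately have wrap: "head G (p ! (k - 1)) = tail G (p ! 0)"
    using T.awalk_verts_conv[of u p] u(3) by (simp add: hd_append hd_map last_conv_nth k_def hd_conv_nth)
  have inj: "i = j" if "head G (p ! i) = head G (p ! j)" "i < k" "j < k" for i j
    using nth_eq_iff_index_eq[OF dist, of i j] that by (simp add: k_def)
  \<comment> \<open>Cyclic predecessor: the arc before the first one is the last one.\<close>
  define prev where "prev = (\<lambda>i. if i = 0 then k - 1 else i - 1)"
  have prev: "head G (p ! prev i) = tail G (p ! i)" "prev i < k" if "i < k" for i
    using that step[of "i - 1"] wrap by (auto simp: prev_def)
  have arc: "p ! i \<in> arcs G" "p ! i \<in> arcs ?T" if "i < k" for i
    using that p pG by (auto simp: k_def subset_iff simp del: arborescence_tree_simps)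
  have "\<exists>i<k. \<forall>j<k. d (tail G (p ! j)) \<le> d (tail G (p ! i))"
  proof -
    have "Max ((\<lambda>i. d (tail G (p ! i))) ` {..<k}) \<in> (\<lambda>i. d (tail G (p ! i))) ` {..<k}"
      using k by (intro Max_in) auto
    then obtain i where "i < k" "Max ((\<lambda>i. d (tail G (p ! i))) ` {..<k}) = d (tail G (p ! i))"
      by auto
    moreover have "d (tail G (p ! j)) \<le> Max ((\<lambda>i. d (tail G (p ! i))) ` {..<k})" if "j < k" for j
      using that by (intro Max_ge) auto
    ultimately show ?thesis by metis
  qed
  then obtain i where i: "i < k" and max: "\<And>j. j < k \<Longrightarrow> d (tail G (p ! j)) \<le> d (tail G (p ! i))"
    by blast
  have next_max: "d (head G (p ! i)) \<le> d (tail G (p ! i))"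
  proof (cases "Suc i < k")
    case True
    then show ?thesis using max step by simp
  next
    case False
    then have "i = k - 1" using i by simp
    then show ?thesis using max[of 0] wrap k by simp
  qed
  \<comment> \<open>An inverse arc \<open>arev (f v)\<close> strictly raises the rank, so a tree arc
    that does not raise it must be the arc chosen by \<open>f\<close> at its tail.\<close>
  have out: "e = f (tail G e)" if "e \<in> arcs ?T" "d (head G e) \<le> d (tail G e)" for e
  proof (rule ccontr)
    assume ne: "e \<noteq> f (tail G e)"
    from that(1) consider v where "v \<in> verts G - {s}" "e = f v" | v where "v \<in> verts G - {s}" "e = arev (f v)"
      by auto
    then show False
    proof cases
      case 1
      with ne show False using arborescences_arc[OF f 1(1)] by simp
    next
      case 2
      with that(2) d[rule_format, OF 2(1)] show False using arborescences_arc[OF f 2(1)] by simp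
    qed
  qed
  have e2: "p ! i = f (tail G (p ! i))"
    using out arc i next_max by blast
  have e1: "p ! prev i = arev (p ! i)"
  proof -
    have "arev (p ! prev i) \<in> arcs ?T"
      using arc(2)[OF prev(2)[OF i]] by auto
    moreover have "d (head G (arev (p ! prev i))) \<le> d (tail G (arev (p ! prev i)))"
      using arc(1)[OF prev(2)[OF i]] prev[OF i] max by simp
    ultimately have "arev (p ! prev i) = f (tail G (p ! i))"
      using out[of "arev (p ! prev i)"] arc(1)[OF prev(2)[OF i]] prev[OF i] by simp
    then show ?thesis using e2 by (metis arev_arev)
  qed
  have nb': "p ! Suc j \<noteq> arev (p ! j)" if "Suc j < k" for j
    using nb that by (simp add: successively_conv_nth k_def)
  show False
  proof (cases "i = 0")
    case False
    then show False using nb'[of "i - 1"] e1 i by (auto simp: prev_def)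
  next
    case True
    then have e1: "p ! (k - 1) = arev (p ! 0)" using e1 by (simp add: prev_def)
    \<comment> \<open>At \<open>i = 0\<close> the backtracking is between the last and the first
      arc, which \<open>successively\<close> does not forbid. A single arc would equal its own
      inverse, two arcs backtrack at the inner step as well, and three or more would enter the
      vertex \<open>head G (p ! 0)\<close> twice.\<close>
    consider "k = 1" | "k = 2" | "k \<ge> 3" using k by linarith
    then show False
    proof cases
      case 1
      then show False using e1 arev_neq[OF arc(1)[of 0]] by simp
    next
      case 2
      then show False using e1 nb'[of 0] by simp
    next
      case 3
      have "tail G (p ! (k - 1)) = head G (p ! 0)"
        using e1 arc(1)[of 0] k by simp
      then have "head G (p ! (k - 2)) = head G (p ! 0)"
        using step[of "k - 2"] 3 by (simp add: numeral_2_eq_2 Suc_diff_Suc)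
      then have "k - 2 = 0" using 3 by (intro inj) auto
      with 3 show False by simp
    qed
  qed
qed

text \<open>An arc \<open>e\<close> of \<open>T\<close> missing from \<open>T'\<close> would close
  up with a simple path of \<open>T'\<close> from its head to its tail to a circuit of
  \<open>T\<close>. So a connected, inversion-closed spanning subgraph of an acyclic graph is the
  whole graph.\<close>

lemma acyclic_minimal_connected:
  assumes wf: "wf_digraph T" and eq: "verts T' = verts T" "tail T' = tail T" "head T' = head T"
    and sub: "arcs T \<subseteq> arcs G" "tail T = tail G" "head T = head G"
    and sub': "arcs T' \<subseteq> arcs T" and inv: "arev ` arcs T' \<subseteq> arcs T'"
    and conn: "strongly_connected T'" and acyc: "\<nexists>p. circuit T arev p"
  shows "arcs T' = arcs T"
proof (rule ccontr)
  interpret T: wf_digraph T by fact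
  interpret T': wf_digraph T'
    using eq sub' T.wellformed by unfold_locales auto
  assume "arcs T' \<noteq> arcs T"
  with sub' obtain e where e: "e \<in> arcs T" "e \<notin> arcs T'" by auto
  have "head T e \<rightarrow>\<^sup>*\<^bsub>T'\<^esub> tail T e"
    using conn e(1) eq(1) by (auto simp: strongly_connected_def)
  then obtain q where "T'.apath (head T e) q (tail T e)"
    by (auto simp: T'.reachable_apath)
  then have q: "T'.awalk (head T e) q (tail T e)" "distinct (T'.awalk_verts (head T e) q)"
    by (auto simp: T'.apath_def)
  have vs: "T'.awalk_verts x p = T.awalk_verts x p" for x p
    by (simp add: T.awalk_verts_conv T'.awalk_verts_conv eq)
  have cas: "T'.cas x p y = T.cas x p y" for x p y
    by (induction p arbitrary: x) (auto simp: eq)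
  have q': "T.awalk (head T e) q (tail T e)" "distinct (T.awalk_verts (head T e) q)" "set q \<subseteq> arcs T'"
    using q sub' eq by (auto simp: T.awalk_def T'.awalk_def vs cas)
  have "T.awalk (tail T e) (e # q) (tail T e)"
    using q'(1) e(1) by (simp add: T.awalk_Cons_iff)
  moreover have "distinct (tl (T.awalk_verts (tail T e) (e # q)))"
    using q'(2) by simp
  ultimately have cyc: "T.cycle (e # q)"
    unfolding T.cycle_def by blast
  \<comment> \<open>Closure of \<open>T'\<close> under inversion excludes \<open>arev e\<close>
    together with \<open>e\<close>, so the circuit does not backtrack right after
    \<open>e\<close>.\<close>
  have "e' \<noteq> arev e" if "e' \<in> set q" for e'
    using that q'(3) inv e(2) by (metis arev_arev image_subset_iff subset_eq)
  then have hd: "q \<noteq> [] \<Longrightarrow> hd q \<noteq> arev e" by simp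
  have "successively (\<lambda>e e'. e' \<noteq> arev e) q"
    unfolding successively_conv_nth
  proof (intro allI impI notI)
    fix i
    assume i: "Suc i < length q" and bt: "q ! Suc i = arev (q ! i)"
    have "T.cas (head T e) q (tail T e)" using q'(1) by (simp add: T.awalk_def)
    then have "map (tail T) q @ [head T (last q)] = tail T (hd q) # map (head T) q"
      using T.awalk_verts_conv[of "head T e" q] T.awalk_verts_conv'[of "head T e" q "tail T e"] i
      by (cases "q = []") auto
    moreover have "distinct (map (tail T) q @ [head T (last q)])"
      using q'(2) T.awalk_verts_conv[of "head T e" q] i by (auto split: if_splits)
    ultimately have d: "distinct (tail T (hd q) # map (head T) q)" by simp
    \<comment> \<open>A backtrack inside \<open>q\<close> would return to the vertex visited two
      steps earlier, against simplicity of the path.\<close>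
    have "q ! i \<in> arcs G" using i q'(3) sub sub' by (meson Suc_lessD nth_mem subset_iff)
    then have "head T (q ! Suc i) = tail T (q ! i)"
      using bt sub by simp
    moreover have "tail T (q ! i) = (tail T (hd q) # map (head T) q) ! i"
      using arg_cong[OF \<open>map (tail T) q @ _ = _\<close>, of "\<lambda>xs. xs ! i"] i by (simp add: nth_append)
    moreover have "head T (q ! Suc i) = (tail T (hd q) # map (head T) q) ! Suc (Suc i)"
      using i by simp
    ultimately have "(tail T (hd q) # map (head T) q) ! Suc (Suc i) = (tail T (hd q) # map (head T) q) ! i"
      by (simp only:)
    then have "Suc (Suc i) = i"
      by (subst (asm) nth_eq_iff_index_eq[OF d]) (use i in auto)
    then show False by simp
  qed
  with hd have "successively (\<lambda>e e'. e' \<noteq> arev e) (e # q)"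
    by (auto simp: successively_Cons)
  with cyc acyc show False by (auto simp: circuit_def)
qed

text \<open>Induction on the rank belonging to \<open>g\<close>. If \<open>g v\<close> were the
  inverse of some \<open>f w\<close>, then \<open>w\<close> would have smaller rank, so
  \<open>f w = g w\<close> by induction; but that arc ends in \<open>v\<close>, which forces the
  rank of \<open>v\<close> below that of \<open>w\<close>.\<close>

lemma arborescence_tree_inj:
  assumes f: "f \<in> arborescences s" and g: "g \<in> arborescences s"
    and eq: "arborescence_tree s f = arborescence_tree s g"
  shows "f = g"
proof -
  obtain d :: "'a \<Rightarrow> nat" where d: "\<forall>v\<in>verts G - {s}. d (head G (g v)) < d v"
    using g by (auto simp: arborescences_def)
  have "f v = g v" if "v \<in> verts G - {s}" for v
    using that
  proof (induction "d v" arbitrary: v rule: less_induct)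
    case less
    have "g v \<in> arcs (arborescence_tree s f)"
      unfolding eq using less.prems by auto
    then consider w where "w \<in> verts G - {s}" "g v = f w" | w where "w \<in> verts G - {s}" "g v = arev (f w)"
      by auto
    then show ?case
    proof cases
      case 1
      then show ?thesis using arborescences_arc[OF f 1(1)] arborescences_arc[OF g less.prems] by simp
    next
      case 2
      then have w: "head G (g v) = w" "tail G (g v) = head G (f w)"
        using arborescences_arc[OF f 2(1)] by auto
      then have "d w < d v" using d less.prems by auto
      then have "f w = g w" using less.hyps 2(1) by blast
      then have "head G (g w) = v" using w arborescences_arc[OF g less.prems] by simp
      then have "d v < d w" using d 2(1) by auto
      with \<open>d w < d v\<close> show ?thesis by simp
    qed
  qed
  moreover have "f \<in> extensional (verts G - {s})" "g \<in> extensional (verts G - {s})"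
    using f g by (auto simp: arborescences_def PiE_iff)
  ultimately show ?thesis by (intro extensionalityI)
qed

text \<open>The rank is the distance to \<open>s\<close>; the first arc of a shortest walk lowers
  it.\<close>

lemma exists_rank_of_reachable:
  assumes "wf_digraph T" "verts T = verts G" and conn: "\<And>v. v \<in> verts G \<Longrightarrow> v \<rightarrow>\<^sup>*\<^bsub>T\<^esub> s"
  obtains d :: "'a \<Rightarrow> nat" where
    "\<And>v. v \<in> verts G - {s} \<Longrightarrow> \<exists>e\<in>out_arcs T v. d (head T e) < d v"
proof -
  interpret T: wf_digraph T by fact
  define d where "d v = (LEAST n. \<exists>p. T.awalk v p s \<and> length p = n)" for v
  have "\<exists>e\<in>out_arcs T v. d (head T e) < d v" if v: "v \<in> verts G - {s}" for v
  proof -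
    have "\<exists>n p. T.awalk v p s \<and> length p = n"
      using conn[of v] v by (auto simp: T.reachable_awalk)
    then have "\<exists>p. T.awalk v p s \<and> length p = d v"
      unfolding d_def by (rule LeastI_ex)
    then obtain p where p: "T.awalk v p s" "length p = d v" by blast
    with v obtain e q where eq: "p = e # q" by (cases p) (auto simp: T.awalk_Nil_iff)
    then have e: "e \<in> out_arcs T v" and q: "T.awalk (head T e) q s"
      using p by (auto simp: T.awalk_Cons_iff)
    have "d (head T e) \<le> length q"
      unfolding d_def using q by (blast intro: Least_le)
    then have "d (head T e) < d v" using p eq by simp
    with e show ?thesis by blast
  qed
  then show ?thesis using that by blast
qed

lemma serre_spanning_tree_arborescence_tree:
  assumes f: "f \<in> arborescences s" and s: "s \<in> verts G"
  shows "serre_spanning_tree G arev (arborescence_tree s f)"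
  using arborescence_tree_subgraph(1,5)[OF f] strongly_connected_arborescence_tree[OF f s]
    no_circuit_arborescence_tree[OF f s]
  unfolding serre_spanning_tree_def by blast

text \<open>Choose at each vertex other than \<open>s\<close> an arc of \<open>T\<close> that
  decreases the distance to \<open>s\<close>. The resulting tree lies inside \<open>T\<close> and is
  connected, so it exhausts \<open>T\<close> by minimality.\<close>

lemma arborescence_of_serre_spanning_tree:
  assumes s: "s \<in> verts G" and "serre_spanning_tree G arev T"
  obtains f where "f \<in> arborescences s" "T = arborescence_tree s f"
proof -
  have T: "spanning T G" "arev ` arcs T \<subseteq> arcs T" "strongly_connected T" "\<nexists>p. circuit T arev p"
    using assms by (auto simp: serre_spanning_tree_def)
  then have wf: "wf_digraph T" and sub: "verts T = verts G" "arcs T \<subseteq> arcs G" "tail T = tail G" "head T = head G"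
    by (auto simp: spanning_def subgraph_def compatible_def)
  obtain d :: "'a \<Rightarrow> nat" where d: "\<And>v. v \<in> verts G - {s} \<Longrightarrow> \<exists>e\<in>out_arcs T v. d (head T e) < d v"
    using exists_rank_of_reachable[OF wf sub(1), of s] T(3) s sub(1)
    unfolding strongly_connected_def by metis
  define f where "f = (\<lambda>v\<in>verts G - {s}. SOME e. e \<in> out_arcs T v \<and> d (head T e) < d v)"
  have fv: "f v \<in> out_arcs T v" "d (head T (f v)) < d v" if "v \<in> verts G - {s}" for v
  proof -
    have "\<exists>e. e \<in> out_arcs T v \<and> d (head T e) < d v" using d[OF that] by blast
    from someI_ex[OF this] show "f v \<in> out_arcs T v" "d (head T (f v)) < d v"
      using that by (simp_all add: f_def del: in_out_arcs_conv)
  qed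
  have f: "f \<in> arborescences s"
    unfolding arborescences_def
  proof (intro CollectI conjI PiE_I exI[of _ d] ballI)
    show "f v \<in> out_arcs G v" if "v \<in> verts G - {s}" for v
      using fv[OF that] sub by auto
    show "d (head G (f v)) < d v" if "v \<in> verts G - {s}" for v
      using fv[OF that] sub by auto
    show "f v = undefined" if "v \<notin> verts G - {s}" for v
      using that by (simp only: f_def restrict_apply if_False)
  qed
  have "arcs (arborescence_tree s f) = arcs T"
  proof (rule acyclic_minimal_connected[OF wf])
    have "f ` (verts G - {s}) \<subseteq> arcs T"
      using fv(1) by (meson image_subsetI in_out_arcs_conv)
    with T(2) show "arcs (arborescence_tree s f) \<subseteq> arcs T"
      unfolding arborescence_tree_simps by blast
    show "strongly_connected (arborescence_tree s f)"
      by (rule strongly_connected_arborescence_tree[OF f s])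
    show "arev ` arcs (arborescence_tree s f) \<subseteq> arcs (arborescence_tree s f)"
      by (rule arborescence_tree_subgraph[OF f])
  qed (use sub T(4) in \<open>simp_all del: arborescence_tree_simps(4)\<close>)
  then have "T = arborescence_tree s f"
    using sub by (intro pre_digraph.equality) (simp_all del: arborescence_tree_simps(4))
  with f show ?thesis by (rule that)
qed

lemma bij_betw_arborescence_tree:
  assumes s: "s \<in> verts G"
  shows "bij_betw (arborescence_tree s) (arborescences s) {T. serre_spanning_tree G arev T}"
  unfolding bij_betw_def inj_on_def
proof (intro conjI equalityI subsetI ballI impI)
  fix f g
  assume "f \<in> arborescences s" "g \<in> arborescences s" "arborescence_tree s f = arborescence_tree s g"
  then show "f = g" by (rule arborescence_tree_inj)
next
  fix T
  assume "T \<in> arborescence_tree s ` arborescences s"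
  then obtain f where "T = arborescence_tree s f" "f \<in> arborescences s" by (rule imageE)
  then show "T \<in> {T. serre_spanning_tree G arev T}"
    using serre_spanning_tree_arborescence_tree[OF _ s] by simp
next
  fix T
  assume "T \<in> {T. serre_spanning_tree G arev T}"
  then have "serre_spanning_tree G arev T" by simp
  then obtain f where "f \<in> arborescences s" "T = arborescence_tree s f"
    by (rule arborescence_of_serre_spanning_tree[OF s])
  then show "T \<in> arborescence_tree s ` arborescences s" by simp
qed

lemma num_spanning_trees_eq_card_arborescences:
  assumes "s \<in> verts G"
  shows "num_spanning_trees G arev = card (arborescences s)"
  using bij_betw_same_card[OF bij_betw_arborescence_tree[OF assms]]
  by (simp add: num_spanning_trees_def)

end

subsection \<open>The matrix-tree theorem\<close>

text \<open>The weight 1 gives the Laplacian, \<open>z powi \<alpha> e\<close> gives D - A(z), and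
  \<open>lp_power (\<alpha> e)\<close> gives \<open>ihara_matrix\<close>. Degrees count all outgoing
  arcs even if \<open>vs\<close> omits vertices, so that deleting a row and the matching column
  amounts to shortening the list.\<close>

definition twisted_laplacian ::
    "('v, 'e) pre_digraph \<Rightarrow> ('e \<Rightarrow> 'a :: comm_ring_1) \<Rightarrow> 'v list \<Rightarrow> 'a mat" where
  "twisted_laplacian X w vs = mat (length vs) (length vs) (\<lambda>(i, j).
     (if i = j then of_nat (card {e \<in> arcs X. tail X e = vs ! i}) else 0) -
     (\<Sum>e | e \<in> arcs X \<and> tail X e = vs ! i \<and> head X e = vs ! j. w e))"

lemma twisted_laplacian_carrier [simp]:
  "twisted_laplacian X w vs \<in> carrier_mat (length vs) (length vs)"
  by (simp add: twisted_laplacian_def)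

lemma mat_delete_twisted_laplacian:
  "mat_delete (twisted_laplacian X w vs) k k =
     twisted_laplacian X w (take k vs @ drop (Suc k) vs)" if "k < length vs"
  using that
  by (intro eq_matI) (auto simp: mat_delete_def twisted_laplacian_def nth_append)

text \<open>Distributivity for a product over positions: determinants are indexed by positions in a
  list, whereas the choice functions live on vertices. The inverse \<open>idx\<close> of
  \<open>(!) ws\<close> translates between the two.\<close>

lemma prod_sum_nth_PiE:
  fixes h :: "nat \<Rightarrow> 'b \<Rightarrow> 'c :: comm_semiring_1"
  assumes "distinct ws" and fin: "\<And>v. v \<in> set ws \<Longrightarrow> finite (B v)"
  shows "(\<Prod>i=0..<length ws. \<Sum>e\<in>B (ws ! i). h i e) =
    (\<Sum>f\<in>PiE (set ws) B. \<Prod>i=0..<length ws. h i (f (ws ! i)))"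
proof -
  define idx where "idx = the_inv_into {0..<length ws} ((!) ws)"
  have bij: "bij_betw ((!) ws) {0..<length ws} (set ws)"
    using assms(1) by (intro bij_betw_nth) auto
  have idx: "idx (ws ! i) = i" if "i < length ws" for i
    using bij that unfolding idx_def bij_betw_def by (intro the_inv_into_f_f) auto
  have "(\<Prod>i=0..<length ws. \<Sum>e\<in>B (ws ! i). h i e) =
      (\<Prod>i=0..<length ws. \<Sum>e\<in>B (ws ! i). h (idx (ws ! i)) e)"
    by (simp add: idx)
  also have "\<dots> = (\<Prod>v\<in>set ws. \<Sum>e\<in>B v. h (idx v) e)"
    by (rule prod.reindex_bij_betw[OF bij])
  also have "\<dots> = (\<Sum>f\<in>PiE (set ws) B. \<Prod>v\<in>set ws. h (idx v) (f v))"
    using fin by (intro prod_sum_PiE) auto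
  also have "\<dots> = (\<Sum>f\<in>PiE (set ws) B. \<Prod>i=0..<length ws. h (idx (ws ! i)) (f (ws ! i)))"
    by (simp only: prod.reindex_bij_betw[OF bij, symmetric])
  finally show ?thesis by (simp add: idx)
qed

section \<open>Incidence determinants of choices of outgoing arcs\<close>

context wf_digraph
begin

text \<open>The signed boundary of an arc, zero for a loop. Summed over the arcs leaving a vertex it
  gives that vertex's row of the Laplacian.\<close>

definition incidence :: "'b \<Rightarrow> 'a \<Rightarrow> 'c :: comm_ring_1" where
  "incidence e v = of_bool (tail G e = v) - of_bool (head G e = v)"

text \<open>Sorted by rank, the matrix is unitriangular. In the Leibniz formula, a permutation other
  than the identity moves some \<open>i\<close> of least rank; \<open>p i\<close> is moved too, so
  its rank is too large for it to be the head of the arc at \<open>i\<close>, and the entry at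
  \<open>(i, p i)\<close> is 0.\<close>

lemma det_incidence_rank:
  fixes f :: "'a \<Rightarrow> 'b" and d :: "'a \<Rightarrow> nat"
  assumes ws: "distinct ws"
    and f: "\<And>v. v \<in> set ws \<Longrightarrow> tail G (f v) = v"
    and d: "\<And>v. v \<in> set ws \<Longrightarrow> d (head G (f v)) < d v"
  shows "det (mat (length ws) (length ws) (\<lambda>(i, j). incidence (f (ws ! i)) (ws ! j))) =
    (1 :: 'c :: comm_ring_1)"
proof -
  let ?m = "length ws"
  let ?a = "\<lambda>i j. incidence (f (ws ! i)) (ws ! j) :: 'c"
  have ne: "head G (f v) \<noteq> v" if "v \<in> set ws" for v
    using d[OF that] by auto
  have off: "(\<Prod>i=0..<?m. ?a i (p i)) = 0" if p: "p permutes {0..<?m}" "p \<noteq> id" for p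
  proof -
    obtain i0 where i0: "p i0 \<noteq> i0" using p(2) by (auto simp: fun_eq_iff)
    define i where "i = (ARG_MIN (\<lambda>i. d (ws ! i)) i. p i \<noteq> i)"
    have i: "p i \<noteq> i" and min: "\<And>j. p j \<noteq> j \<Longrightarrow> d (ws ! i) \<le> d (ws ! j)"
      using arg_min_nat_lemma[of "\<lambda>i. p i \<noteq> i" i0 "\<lambda>i. d (ws ! i)"] i0 by (auto simp: i_def)
    have im: "i < ?m" using i p(1) by (meson atLeastLessThan_iff permutes_not_in zero_le)
    have pim: "p i < ?m" using im permutes_in_image[OF p(1), of i] by simp
    have "p (p i) \<noteq> p i" using i permutes_inj[OF p(1)] by (metis injD)
    from min[OF this] have "head G (f (ws ! i)) \<noteq> ws ! p i"
      using d[of "ws ! i"] im by auto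
    moreover have "tail G (f (ws ! i)) \<noteq> ws ! p i"
      using f[of "ws ! i"] im pim i ws by (simp add: nth_eq_iff_index_eq)
    ultimately have "?a i (p i) = 0" by (simp add: incidence_def)
    with im show ?thesis by (intro prod_zero) auto
  qed
  have "det (mat ?m ?m (\<lambda>(i, j). ?a i j)) =
      (\<Sum>p | p permutes {0..<?m}. signof p * (\<Prod>i=0..<?m. ?a i (p i)))"
    by (subst det_def'[of _ ?m]) (auto intro!: sum.cong prod.cong simp: permutes_in_image)
  also have "\<dots> = (\<Sum>p\<in>{id}. signof p * (\<Prod>i=0..<?m. ?a i (p i)))"
    by (rule sum.mono_neutral_right) (auto simp: off finite_permutations permutes_id)
  also have "\<dots> = 1"
    using f ne by (simp add: incidence_def signof_id)
  finally show ?thesis .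
qed

text \<open>Let \<open>U\<close> be the set of vertices from which following \<open>f\<close> never
  reaches \<open>s\<close>. It is nonempty, since otherwise the number of steps to \<open>s\<close>
  would be a rank, and \<open>f\<close> neither enters nor leaves it. Its indicator is therefore a
  nonzero kernel vector.\<close>

lemma det_incidence_no_rank:
  assumes ws: "distinct ws" "set ws = verts G - {s}"
    and f: "f \<in> (\<Pi>\<^sub>E v\<in>verts G - {s}. out_arcs G v)" and no: "f \<notin> arborescences s"
  shows "det (mat (length ws) (length ws) (\<lambda>(i, j). incidence (f (ws ! i)) (ws ! j))) =
    (0 :: 'c :: idom)"
proof -
  let ?m = "length ws"
  let ?a = "\<lambda>i j. incidence (f (ws ! i)) (ws ! j) :: 'c"
  define R where "R = {(v, head G (f v)) | v. v \<in> verts G - {s}}"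
  define U where "U = {v \<in> verts G. (v, s) \<notin> R\<^sup>*}"
  have fv: "f v \<in> arcs G" "tail G (f v) = v" if "v \<in> verts G - {s}" for v
    using f that by (auto simp: PiE_iff)
  have "U \<noteq> {}"
  proof
    assume "U = {}"
    then have reach: "(v, s) \<in> R\<^sup>*" if "v \<in> verts G" for v using that by (auto simp: U_def)
    define d where "d v = (LEAST n. (v, s) \<in> R ^^ n)" for v
    have "d (head G (f v)) < d v" if v: "v \<in> verts G - {s}" for v
    proof -
      have "\<exists>n. (v, s) \<in> R ^^ n" using reach[of v] v by (auto simp: rtrancl_power)
      then have dv: "(v, s) \<in> R ^^ d v" unfolding d_def by (rule LeastI_ex)
      with v obtain k where k: "d v = Suc k" by (cases "d v") auto
      with dv obtain w where "(v, w) \<in> R" "(w, s) \<in> R ^^ k" by (metis relpow_Suc_D2)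
      then have "(head G (f v), s) \<in> R ^^ k" by (auto simp: R_def)
      then have "d (head G (f v)) \<le> k" unfolding d_def by (rule Least_le)
      with k show ?thesis by simp
    qed
    with f no show False by (auto simp: arborescences_def)
  qed
  have U_step: "v \<in> U \<longleftrightarrow> head G (f v) \<in> U" if v: "v \<in> verts G - {s}" for v
  proof -
    have "(v, head G (f v)) \<in> R" using v by (auto simp: R_def)
    moreover have "(head G (f v), s) \<in> R\<^sup>*" if "(v, s) \<in> R\<^sup>*"
      using that by (rule converse_rtranclE) (use v in \<open>auto simp: R_def\<close>)
    ultimately show ?thesis
      using v fv[OF v] by (auto simp: U_def intro: converse_rtrancl_into_rtrancl)
  qed
  \<comment> \<open>The root reaches itself in zero steps, so it is not in \<open>U\<close>; the
    indicator survives the removal of the root's column.\<close>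
  have Us: "U \<subseteq> set ws" by (auto simp: U_def ws(2))
  have bij: "bij_betw ((!) ws) {0..<?m} (set ws)"
    using ws(1) by (intro bij_betw_nth) auto
  have ind: "(\<Sum>j=0..<?m. of_bool (y = ws ! j) * of_bool (ws ! j \<in> U)) = (of_bool (y \<in> U) :: 'c)" for y
  proof -
    have "(\<Sum>j=0..<?m. of_bool (y = ws ! j) * of_bool (ws ! j \<in> U)) =
        (\<Sum>v\<in>set ws. of_bool (y = v) * of_bool (v \<in> U) :: 'c)"
      by (rule sum.reindex_bij_betw[OF bij])
    also have "\<dots> = (\<Sum>v\<in>set ws. if y = v then of_bool (v \<in> U) else 0)"
      by (intro sum.cong) auto
    also have "\<dots> = of_bool (y \<in> U)" using Us by auto
    finally show ?thesis .
  qed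
  let ?x = "vec ?m (\<lambda>j. of_bool (ws ! j \<in> U)) :: 'c vec"
  let ?M = "mat ?m ?m (\<lambda>(i, j). ?a i j)"
  have "?x \<noteq> 0\<^sub>v ?m"
  proof
    assume eq: "?x = 0\<^sub>v ?m"
    obtain u where "u \<in> U" using \<open>U \<noteq> {}\<close> by blast
    with Us obtain j where j: "j < ?m" "ws ! j \<in> U" by (metis in_set_conv_nth subsetD)
    have "?x $ j = 0" unfolding eq using j by simp
    with j show False by simp
  qed
  moreover have "?M *\<^sub>v ?x = 0\<^sub>v ?m"
  proof (rule eq_vecI)
    fix i assume "i < dim_vec (0\<^sub>v ?m :: 'c vec)"
    then have i: "i < ?m" by simp
    then have v: "ws ! i \<in> verts G - {s}" using ws(2) nth_mem by blast
    have "(?M *\<^sub>v ?x) $ i = (\<Sum>j=0..<?m. ?a i j * of_bool (ws ! j \<in> U))"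
      using i by (simp add: scalar_prod_def)
    also have "\<dots> = of_bool (ws ! i \<in> U) - of_bool (head G (f (ws ! i)) \<in> U)"
      using fv[OF v] by (simp add: incidence_def left_diff_distrib sum_subtractf ind)
    finally show "(?M *\<^sub>v ?x) $ i = 0\<^sub>v ?m $ i" using U_step[OF v] i by simp
  qed simp
  ultimately show ?thesis
    by (subst det_0_iff_vec_prod_zero[of _ ?m]) (auto intro!: exI[of _ ?x])
qed

end

text \<open>Each row is the sum of the incidence rows of the arcs leaving its vertex. Multilinearity
  expands the determinant over all choices of one outgoing arc per non-root vertex, and a choice
  contributes 1 or 0 according to whether it is an arborescence.\<close>

lemma (in fin_digraph) det_reduced_laplacian:
  assumes ws: "distinct ws" "set ws = verts G - {s}"
  shows "det (twisted_laplacian G (\<lambda>_. 1) ws) = (of_nat (card (arborescences s)) :: 'c :: idom)"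
proof -
  let ?m = "length ws"
  let ?F = "\<Pi>\<^sub>E v\<in>set ws. out_arcs G v"
  let ?a = "\<lambda>e v. incidence e v :: 'c"
  have entry: "twisted_laplacian G (\<lambda>_. 1) ws $$ (i, j) = (\<Sum>e\<in>out_arcs G (ws ! i). ?a e (ws ! j))"
    if "i < ?m" "j < ?m" for i j
  proof -
    have "(\<Sum>e\<in>out_arcs G (ws ! i). ?a e (ws ! j)) =
      (\<Sum>e\<in>out_arcs G (ws ! i). of_bool (i = j)) - (\<Sum>e\<in>out_arcs G (ws ! i). of_bool (head G e = ws ! j))"
      unfolding sum_subtractf[symmetric] incidence_def
      using that ws(1) by (intro sum.cong) (auto simp: nth_eq_iff_index_eq)
    moreover have "out_arcs G (ws ! i) = {e \<in> arcs G. tail G e = ws ! i}" by auto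
    ultimately show ?thesis
      using that by (simp add: twisted_laplacian_def Int_def conj_assoc)
  qed
  have finF: "finite ?F" by (intro finite_PiE) auto
  have "det (twisted_laplacian G (\<lambda>_. 1) ws) =
    (\<Sum>p | p permutes {0..<?m}. signof p * (\<Prod>i=0..<?m. \<Sum>e\<in>out_arcs G (ws ! i). ?a e (ws ! p i)))"
    by (subst det_def'[of _ ?m]) (auto intro!: sum.cong prod.cong simp: permutes_in_image entry)
  also have "\<dots> = (\<Sum>p | p permutes {0..<?m}. \<Sum>f\<in>?F. signof p * (\<Prod>i=0..<?m. ?a (f (ws ! i)) (ws ! p i)))"
    using ws(1) by (subst prod_sum_nth_PiE) (auto simp: sum_distrib_left)
  also have "\<dots> = (\<Sum>f\<in>?F. \<Sum>p | p permutes {0..<?m}. signof p * (\<Prod>i=0..<?m. ?a (f (ws ! i)) (ws ! p i)))"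
    by (rule sum.swap)
  also have "\<dots> = (\<Sum>f\<in>?F. det (mat ?m ?m (\<lambda>(i, j). ?a (f (ws ! i)) (ws ! j))))"
    by (subst det_def'[of _ ?m]) (auto intro!: sum.cong prod.cong simp: permutes_in_image)
  also have "\<dots> = (\<Sum>f\<in>?F. of_bool (f \<in> arborescences s))"
  proof (intro sum.cong refl)
    fix f assume f: "f \<in> ?F"
    show "det (mat ?m ?m (\<lambda>(i, j). ?a (f (ws ! i)) (ws ! j))) = of_bool (f \<in> arborescences s)"
    proof (cases "f \<in> arborescences s")
      case True
      then obtain d :: "'a \<Rightarrow> nat" where d: "\<forall>v\<in>verts G - {s}. d (head G (f v)) < d v"
        by (auto simp: arborescences_def)
      have "det (mat ?m ?m (\<lambda>(i, j). ?a (f (ws ! i)) (ws ! j))) = 1"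
        by (rule det_incidence_rank[of _ _ d]) (use d ws arborescences_arc[OF True] in auto)
      with True show ?thesis by simp
    next
      case False
      with det_incidence_no_rank[OF ws _ False] f ws(2) show ?thesis by simp
    qed
  qed
  also have "\<dots> = of_nat (card {f \<in> ?F. f \<in> arborescences s})"
    using finF by (simp add: Int_def)
  also have "{f \<in> ?F. f \<in> arborescences s} = arborescences s"
    using ws(2) by (auto simp: arborescences_def)
  finally show ?thesis .
qed

lemma matrix_tree:
  assumes "bidirected_digraph X r" "fin_digraph X" "distinct vs" "set vs = verts X" "k < length vs"
  shows "det (mat_delete (twisted_laplacian X (\<lambda>_. 1) vs) k k) =
    (of_nat (num_spanning_trees X r) :: 'c :: idom)"
proof -
  interpret bidirected_digraph X r by fact
  interpret fin_digraph X by fact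
  let ?ws = "take k vs @ drop (Suc k) vs"
  have eq: "vs = take k vs @ vs ! k # drop (Suc k) vs"
    using assms(5) by (rule id_take_nth_drop)
  have "distinct (take k vs @ vs ! k # drop (Suc k) vs)"
    using assms(3) eq by simp
  then have "distinct ?ws" "vs ! k \<notin> set ?ws" by auto
  moreover have "set vs = insert (vs ! k) (set ?ws)"
    by (subst eq) simp
  ultimately have "distinct ?ws" "set ?ws = verts X - {vs ! k}"
    using assms(4) by auto
  then have "det (twisted_laplacian X (\<lambda>_. 1) ?ws) = (of_nat (card (arborescences (vs ! k))) :: 'c)"
    by (rule det_reduced_laplacian)
  then show ?thesis
    using assms(5) num_spanning_trees_eq_card_arborescences[of "vs ! k"] nth_mem[OF assms(5)]
    unfolding assms(4) by (simp add: mat_delete_twisted_laplacian)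
qed

section \<open>The linear coefficient of the characteristic polynomial\<close>

lemma poly_char_poly_0:
  fixes A :: "'a :: comm_ring_1 mat"
  assumes "A \<in> carrier_mat n n"
  shows "poly (char_poly A) 0 = (-1) ^ n * det A"
proof -
  have "poly (char_poly A) 0 = det (map_mat (\<lambda>p. poly p 0) (char_poly_matrix A))"
    unfolding char_poly_def by (rule comm_ring_hom.hom_det[OF poly_hom.comm_ring_hom_axioms, symmetric])
  also have "map_mat (\<lambda>p. poly p 0) (char_poly_matrix A) = (-1) \<cdot>\<^sub>m A"
    using assms by (intro eq_matI) (auto simp: char_poly_matrix_def)
  finally show ?thesis using assms by simp
qed

text \<open>The derivative of a characteristic polynomial is the sum of those of the principal
  submatrices with one index deleted. At 0 each of these is, up to the sign of size
  \<open>length vs - 1\<close>, a principal minor counted by \<open>matrix_tree\<close>.\<close>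

lemma pderiv_char_poly_laplacian:
  assumes "bidirected_digraph X r" "fin_digraph X" "distinct vs" "set vs = verts X"
  shows "poly (pderiv (char_poly (twisted_laplacian X (\<lambda>_. 1) vs))) 0 =
    (-1) ^ (length vs - 1) * of_nat (length vs) * (of_nat (num_spanning_trees X r) :: 'c :: idom)"
proof -
  let ?L = "twisted_laplacian X (\<lambda>_. 1) vs :: 'c mat"
  have "poly (pderiv (char_poly ?L)) 0 = (\<Sum>i<length vs. poly (char_poly (mat_delete ?L i i)) 0)"
    by (subst pderiv_char_poly[of _ "length vs"]) (auto simp: poly_sum)
  also have "\<dots> = (\<Sum>i<length vs. (-1) ^ (length vs - 1) * of_nat (num_spanning_trees X r))"
  proof (intro sum.cong refl)
    fix i assume "i \<in> {..<length vs}"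
    then have "det (mat_delete ?L i i) = of_nat (num_spanning_trees X r)"
      using assms by (intro matrix_tree) auto
    moreover have "poly (char_poly (mat_delete ?L i i)) 0 = (-1) ^ (length vs - 1) * det (mat_delete ?L i i)"
      by (rule poly_char_poly_0) (rule mat_delete_carrier[OF twisted_laplacian_carrier])
    ultimately show "poly (char_poly (mat_delete ?L i i)) 0 = (-1) ^ (length vs - 1) * of_nat (num_spanning_trees X r)"
      by simp
  qed
  also have "\<dots> = (-1) ^ (length vs - 1) * of_nat (length vs) * of_nat (num_spanning_trees X r)"
    by simp
  finally show ?thesis .
qed

subsection \<open>The Laplacian of a cyclic cover\<close>

text \<open>An index \<open>a\<close> encodes the pair of block \<open>a div g\<close> and position
  \<open>a mod g\<close>. \<open>cyclic_cover_verts\<close> lists the cover sheet by sheet with the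
  same encoding.\<close>

definition block_diag :: "nat \<Rightarrow> nat \<Rightarrow> (nat \<Rightarrow> 'a :: zero mat) \<Rightarrow> 'a mat" where
  "block_diag g n B = mat (n * g) (n * g)
     (\<lambda>(a, b). if a div g = b div g then B (a div g) $$ (a mod g, b mod g) else 0)"

lemma block_diag_carrier [simp]: "block_diag g n B \<in> carrier_mat (n * g) (n * g)"
  by (simp add: block_diag_def)

lemma dim_block_diag [simp]:
  "dim_row (block_diag g n B) = n * g" "dim_col (block_diag g n B) = n * g"
  by (simp_all add: block_diag_def)

lemma block_diag_Suc:
  assumes "B n \<in> carrier_mat g g"
  shows "block_diag g (Suc n) B =
    four_block_mat (block_diag g n B) (0\<^sub>m (n * g) g) (0\<^sub>m g (n * g)) (B n)"
proof (rule eq_matI)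
  fix a b
  assume ab: "a < dim_row (four_block_mat (block_diag g n B) (0\<^sub>m (n * g) g) (0\<^sub>m g (n * g)) (B n))"
    "b < dim_col (four_block_mat (block_diag g n B) (0\<^sub>m (n * g) g) (0\<^sub>m g (n * g)) (B n))"
  then have ab: "a < n * g + g" "b < n * g + g"
    using assms by (auto simp: block_diag_def)
  then have g: "g > 0" by (cases g) auto
  have low: "c div g < n" if "c < n * g" for c
    using that by (simp add: less_mult_imp_div_less)
  have high: "c div g = n" "c mod g = c - n * g" if "\<not> c < n * g" "c < n * g + g" for c
  proof -
    have "c = n * g + (c - n * g)" "c - n * g < g" using that by auto
    then show "c div g = n" "c mod g = c - n * g"
      by (metis div_mult_self3 g less_not_refl2 div_less add_0 mult.commute add.commute,
          metis mod_less mod_mult_self3)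
  qed
  show "block_diag g (Suc n) B $$ (a, b) =
      four_block_mat (block_diag g n B) (0\<^sub>m (n * g) g) (0\<^sub>m g (n * g)) (B n) $$ (a, b)"
    using ab assms low[of a] low[of b] high[of a] high[of b]
    by (cases "a < n * g"; cases "b < n * g") (auto simp: block_diag_def)
qed (use assms in \<open>auto simp: block_diag_def\<close>)

lemma det_block_diag:
  fixes B :: "nat \<Rightarrow> 'a :: idom mat"
  assumes "\<And>k. B k \<in> carrier_mat g g"
  shows "det (block_diag g n B) = (\<Prod>k<n. det (B k))"
proof (induction n)
  case 0
  then show ?case by (simp add: block_diag_def)
next
  case (Suc n)
  then show ?case
    using assms
    by (subst block_diag_Suc) (auto simp: det_four_block_mat_upper_right_zero[of _ "n * g" _ g])
qed

lemma char_poly_block_diag: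
  fixes B :: "nat \<Rightarrow> 'a :: idom mat"
  assumes "\<And>k. B k \<in> carrier_mat g g" "g > 0"
  shows "char_poly (block_diag g n B) = (\<Prod>k<n. char_poly (B k))"
proof -
  have "char_poly_matrix (block_diag g n B) = block_diag g n (\<lambda>k. char_poly_matrix (B k))"
  proof (rule eq_matI)
    fix a b
    assume "a < dim_row (block_diag g n (\<lambda>k. char_poly_matrix (B k)))"
      "b < dim_col (block_diag g n (\<lambda>k. char_poly_matrix (B k)))"
    then have ab: "a < n * g" "b < n * g" by (auto simp: block_diag_def)
    have "a mod g < g" "b mod g < g" using assms(2) by auto
    moreover have "dim_row (B k) = g" "dim_col (B k) = g" for k using assms(1)[of k] by auto
    moreover have "a = b" if "a div g = b div g" "a mod g = b mod g"
      using that by (metis div_mult_mod_eq)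
    ultimately show "char_poly_matrix (block_diag g n B) $$ (a, b) =
        block_diag g n (\<lambda>k. char_poly_matrix (B k)) $$ (a, b)"
      using ab by (auto simp: char_poly_matrix_def block_diag_def)
  qed (auto simp: char_poly_matrix_def block_diag_def)
  then show ?thesis
    using assms by (simp add: char_poly_def det_block_diag)
qed

lemma sum_div_mod:
  fixes h :: "nat \<Rightarrow> nat \<Rightarrow> 'a :: comm_monoid_add"
  shows "(\<Sum>c<n * g. h (c div g) (c mod g)) = (\<Sum>k<n. \<Sum>j<g. h k j)"
proof (cases "g = 0")
  case False
  have "(\<Sum>c<n * g. h (c div g) (c mod g)) = (\<Sum>k<n. \<Sum>c\<in>{k * g..<k * g + g}. h (c div g) (c mod g))"
    by (rule sum.nat_group[symmetric])
  also have "\<dots> = (\<Sum>k<n. \<Sum>j<g. h k j)"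
  proof (rule sum.cong[OF refl])
    fix k
    have "(\<Sum>c\<in>{k * g..<k * g + g}. h (c div g) (c mod g)) =
        (\<Sum>j=0..<g. h ((j + k * g) div g) ((j + k * g) mod g))"
      using sum.shift_bounds_nat_ivl[of "\<lambda>c. h (c div g) (c mod g)" 0 "k * g" g] by (simp add: add.commute)
    also have "\<dots> = (\<Sum>j<g. h k j)"
      using False by (intro sum.cong) auto
    finally show "(\<Sum>c\<in>{k * g..<k * g + g}. h (c div g) (c mod g)) = (\<Sum>j<g. h k j)" .
  qed
  finally show ?thesis .
qed simp

text \<open>Serves to replace the residues of voltages, which occur in the cover, by the integer
  voltages, which occur in A(z).\<close>

lemma power_int_mod_exponent:
  fixes z :: "'a :: field"
  assumes "z ^ n = 1" "n > 0"
  shows "z powi (m mod int n) = z powi m"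
proof -
  have "z \<noteq> 0" using assms by (auto simp: power_0_left)
  have "z powi m = z powi (int n * (m div int n) + m mod int n)" by simp
  also have "\<dots> = z powi (int n * (m div int n)) * z powi (m mod int n)"
    using \<open>z \<noteq> 0\<close> by (intro power_int_add disjI1)
  also have "z powi (int n * (m div int n)) = 1"
    using assms by (simp add: power_int_mult)
  finally show ?thesis by simp
qed

lemma sum_powers_root_of_unity:
  fixes w :: "'a :: field"
  assumes "w ^ n = 1"
  shows "(\<Sum>k<n. w ^ k) = (if w = 1 then of_nat n else 0)"
  using assms geometric_sum[of w n] by simp

text \<open>This is X_n for positive \<open>n\<close>: the carrier of
  \<open>integer_mod_group n\<close> then consists of the representatives 0 to n - 1, so the
  quotient map is reduction by \<open>mod\<close>.\<close>

definition cyclic_cover ::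
    "('v, 'e) pre_digraph \<Rightarrow> ('e \<Rightarrow> int) \<Rightarrow> nat \<Rightarrow> ('v \<times> int, 'e \<times> int) pre_digraph" where
  "cyclic_cover X \<alpha> n = derived_graph X (integer_mod_group n) (\<lambda>a. \<alpha> a mod int n)"

definition cyclic_cover_verts :: "'v list \<Rightarrow> nat \<Rightarrow> ('v \<times> int) list" where
  "cyclic_cover_verts vs n =
     map (\<lambda>a. (vs ! (a mod length vs), int (a div length vs))) [0..<n * length vs]"

lemma cyclic_cover_simps:
  assumes "n > 0"
  shows "verts (cyclic_cover X \<alpha> n) = verts X \<times> {0..<int n}"
    "arcs (cyclic_cover X \<alpha> n) = arcs X \<times> {0..<int n}"
    "tail (cyclic_cover X \<alpha> n) (e, \<sigma>) = (tail X e, \<sigma>)"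
    "head (cyclic_cover X \<alpha> n) (e, \<sigma>) = (head X e, (\<sigma> + \<alpha> e) mod int n)"
  using assms by (auto simp: cyclic_cover_def derived_graph_def carrier_integer_mod_group mod_add_right_eq)

lemma distinct_cyclic_cover_verts:
  assumes "distinct vs"
  shows "distinct (cyclic_cover_verts vs n)"
proof (cases "vs = []")
  case False
  have "inj_on (\<lambda>a. (vs ! (a mod length vs), int (a div length vs))) {0..<n * length vs}"
  proof (rule inj_onI)
    fix a b
    assume eq: "(vs ! (a mod length vs), int (a div length vs)) = (vs ! (b mod length vs), int (b div length vs))"
    then have "a mod length vs = b mod length vs"
      using assms False by (simp add: nth_eq_iff_index_eq)
    with eq show "a = b" by (metis div_mult_mod_eq of_nat_eq_iff prod.inject)
  qed
  then show ?thesis by (simp add: cyclic_cover_verts_def distinct_map)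
qed (simp add: cyclic_cover_verts_def)

lemma set_cyclic_cover_verts:
  "set (cyclic_cover_verts vs n) = set vs \<times> {0..<int n}"
proof (intro equalityI subsetI)
  fix x assume "x \<in> set (cyclic_cover_verts vs n)"
  then obtain a where a: "a < n * length vs" "x = (vs ! (a mod length vs), int (a div length vs))"
    by (auto simp: cyclic_cover_verts_def)
  then have "length vs > 0" by (cases "length vs") auto
  then show "x \<in> set vs \<times> {0..<int n}"
    using a by (auto simp: less_mult_imp_div_less)
next
  fix x assume "x \<in> set vs \<times> {0..<int n}"
  then obtain i \<sigma> where x: "x = (vs ! i, \<sigma>)" and i: "i < length vs" and \<sigma>: "0 \<le> \<sigma>" "\<sigma> < int n"
    by (auto simp: in_set_conv_nth)
  define k where "k = nat \<sigma>"
  have k: "\<sigma> = int k" "k < n" using \<sigma> by (auto simp: k_def)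
  have "i + k * length vs < Suc k * length vs" using i by simp
  also have "\<dots> \<le> n * length vs" using k by (intro mult_right_mono) auto
  finally have "i + k * length vs < n * length vs" .
  moreover have "(i + k * length vs) mod length vs = i" "(i + k * length vs) div length vs = k"
    using i by (auto simp: div_mult_self1[OF gr_implies_not0[OF i]])
  ultimately show "x \<in> set (cyclic_cover_verts vs n)"
    unfolding cyclic_cover_verts_def x k(1) set_map set_upt
    by (intro image_eqI[of _ _ "i + k * length vs"]) auto
qed

lemma bidirected_cyclic_cover:
  assumes "bidirected_digraph X r" and "voltage_assignment X r integer_group \<alpha>"
  shows "bidirected_digraph (cyclic_cover X \<alpha> n)
    (derived_inversion X r (integer_mod_group n) (\<lambda>a. \<alpha> a mod int n))"
  unfolding cyclic_cover_def
proof (rule bidirected_digraph_derived)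
  have "\<alpha> (r e) = - \<alpha> e" if "e \<in> arcs X" for e
    using assms(2) that by (auto simp: voltage_assignment_def)
  then show "voltage_assignment X r (integer_mod_group n) (\<lambda>a. \<alpha> a mod int n)"
    by (auto simp: voltage_assignment_def carrier_integer_mod_group mod_minus_eq)
qed (use assms in auto)

lemma fin_digraph_cyclic_cover:
  assumes "fin_digraph X" "n > 0"
  shows "fin_digraph (cyclic_cover X \<alpha> n)"
proof -
  interpret fin_digraph X by fact
  show ?thesis
    by unfold_locales (auto simp: cyclic_cover_simps[OF assms(2)])
qed

text \<open>The columns of \<open>F\<close> below are the functions \<open>(v, \<sigma>) \<mapsto> z\<^sub>k\<^sup>\<sigma>\<close> supported on the fibre of one vertex.\<close>

lemma similar_laplacian_cyclic_cover:
  fixes z :: "nat \<Rightarrow> 'c :: field_char_0"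
  assumes X: "fin_digraph X" and vs: "distinct vs" and n: "n > 0"
    and z: "inj_on z {..<n}" "\<And>k. z k ^ n = 1"
  shows "similar_mat (twisted_laplacian (cyclic_cover X \<alpha> n) (\<lambda>_. 1) (cyclic_cover_verts vs n))
    (block_diag (length vs) n (\<lambda>k. twisted_laplacian X (\<lambda>e. z k powi \<alpha> e) vs))"
proof -
  interpret fin_digraph X by fact
  let ?g = "length vs"
  let ?N = "n * ?g"
  let ?Y = "cyclic_cover X \<alpha> n"
  let ?ws = "cyclic_cover_verts vs n"
  let ?L = "twisted_laplacian ?Y (\<lambda>_. 1) ?ws :: 'c mat"
  let ?B = "\<lambda>k. twisted_laplacian X (\<lambda>e. z k powi \<alpha> e) vs"
  let ?D = "block_diag ?g n ?B"
  define F where "F = mat ?N ?N (\<lambda>(a, b). if a mod ?g = b mod ?g then z (b div ?g) ^ (a div ?g) else 0)"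
  \<comment> \<open>The inverse discrete Fourier transform on each fibre. Inverses of the roots
    stand in for complex conjugates, as the field is arbitrary of characteristic 0.\<close>
  define F' where "F' = mat ?N ?N (\<lambda>(a, b). if a mod ?g = b mod ?g
    then inverse (z (a div ?g)) ^ (b div ?g) / of_nat n else 0)"
  have carrier: "F \<in> carrier_mat ?N ?N" "F' \<in> carrier_mat ?N ?N" "?D \<in> carrier_mat ?N ?N"
    by (auto simp: F_def F'_def)
  have len: "length ?ws = ?N" by (simp add: cyclic_cover_verts_def)
  have L: "?L \<in> carrier_mat ?N ?N"
    using twisted_laplacian_carrier[of ?Y "\<lambda>_. 1 :: 'c" ?ws] by (simp only: len)
  have z0: "z k \<noteq> 0" for k using z(2)[of k] n by (auto simp: power_0_left)
  have dm: "a div ?g < n" "a mod ?g < ?g" if "a < ?N" for a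
    using that by (auto simp: less_mult_imp_div_less) (metis less_nat_zero_code mod_less_divisor mult_0_right neq0_conv list.size(3))
  have dm_eq: "a = b \<longleftrightarrow> a div ?g = b div ?g \<and> a mod ?g = b mod ?g" for a b
    by (metis div_mult_mod_eq)
  have sum_eq_if: "(\<Sum>l<?g. if i = l \<and> l = j then x else 0) = (if i = j then x else 0)"
    if "i < ?g" for i j and x :: 'c
  proof -
    have "(\<Sum>l<?g. if i = l \<and> l = j then x else 0) = (\<Sum>l<?g. if l = i then (if i = j then x else 0) else 0)"
      by (intro sum.cong) auto
    also have "\<dots> = (if i = j then x else 0)" using that by simp
    finally show ?thesis .
  qed
  \<comment> \<open>Orthogonality of characters: the entry is a sum of powers of a quotient of two
    n-th roots of unity, and injectivity of \<open>z\<close> makes that quotient 1 only on the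
    diagonal blocks.\<close>
  have "F' * F = 1\<^sub>m ?N"
  proof (rule eq_matI)
    fix a b assume "a < dim_row (1\<^sub>m ?N :: 'c mat)" "b < dim_col (1\<^sub>m ?N :: 'c mat)"
    then have ab: "a < ?N" "b < ?N" by auto
    let ?w = "z (b div ?g) / z (a div ?g)"
    have "(F' * F) $$ (a, b) = (\<Sum>c<?N. (if a mod ?g = c mod ?g \<and> c mod ?g = b mod ?g
        then ?w ^ (c div ?g) / of_nat n else 0))"
      using ab by (auto simp: F_def F'_def scalar_prod_def lessThan_atLeast0 power_divide divide_simps
          power_inverse intro!: sum.cong)
    also have "\<dots> = (\<Sum>k<n. \<Sum>j<?g. if a mod ?g = j \<and> j = b mod ?g then ?w ^ k / of_nat n else 0)"
      by (rule sum_div_mod[of "\<lambda>k j. if a mod ?g = j \<and> j = b mod ?g then ?w ^ k / of_nat n else 0"])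
    also have "\<dots> = (\<Sum>k<n. if a mod ?g = b mod ?g then ?w ^ k / of_nat n else 0)"
      using dm(2)[OF ab(1)] by (simp only: sum_eq_if)
    also have "\<dots> = (if a mod ?g = b mod ?g then (\<Sum>k<n. ?w ^ k) / of_nat n else 0)"
      by (simp add: sum_divide_distrib)
    also have "(\<Sum>k<n. ?w ^ k) = (if ?w = 1 then of_nat n else 0)"
      by (rule sum_powers_root_of_unity) (simp add: power_divide z(2))
    also have "?w = 1 \<longleftrightarrow> a div ?g = b div ?g"
      using z0 z(1) dm(1)[OF ab(1)] dm(1)[OF ab(2)] by (auto simp: inj_on_def)
    finally show "(F' * F) $$ (a, b) = 1\<^sub>m ?N $$ (a, b)"
      using ab n dm_eq[of a b] by auto
  qed (use carrier in auto)
  moreover from this have "F * F' = 1\<^sub>m ?N"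
    using carrier by (intro mat_mult_left_right_inverse[of F' _ F])
  \<comment> \<open>An arc over \<open>e\<close> starting in sheet \<open>\<sigma>\<close> ends in
    sheet \<open>\<sigma> + \<alpha> e\<close>, where the character is multiplied by
    \<open>z k powi \<alpha> e\<close>. Hence both entries equal \<open>z k ^ \<sigma>\<close> times
    the entry of the k-th block.\<close>
  moreover have "?L * F = F * ?D"
  proof (rule eq_matI)
    fix a b assume "a < dim_row (F * ?D)" "b < dim_col (F * ?D)"
    then have ab: "a < ?N" "b < ?N" using carrier by auto
    define i \<sigma> j k where "i = a mod ?g" and "\<sigma> = a div ?g" and "j = b mod ?g" and "k = b div ?g"
    have ij: "i < ?g" "\<sigma> < n" "j < ?g" "k < n"
      using dm ab by (auto simp: i_def \<sigma>_def j_def k_def)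
    define E where "E = {e \<in> arcs X. tail X e = vs ! i \<and> head X e = vs ! j}"
    have finE: "finite E" by (simp add: E_def)
    have ws: "?ws ! c = (vs ! (c mod ?g), int (c div ?g))" if "c < ?N" for c
      using that by (simp add: cyclic_cover_verts_def)
    have deg: "card {e \<in> arcs ?Y. tail ?Y e = (vs ! i, int \<sigma>)} = card {e \<in> arcs X. tail X e = vs ! i}"
    proof -
      have "{e \<in> arcs ?Y. tail ?Y e = (vs ! i, int \<sigma>)} = (\<lambda>e. (e, int \<sigma>)) ` {e \<in> arcs X. tail X e = vs ! i}"
        using ij by (auto simp: cyclic_cover_simps[OF n])
      then show ?thesis by (simp add: card_image inj_on_def)
    qed
    have edges: "(\<Sum>e | e \<in> arcs ?Y \<and> tail ?Y e = (vs ! i, int \<sigma>) \<and> head ?Y e = (vs ! j, int \<tau>). 1) =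
        (\<Sum>e\<in>E. if nat ((int \<sigma> + \<alpha> e) mod int n) = \<tau> then 1 else 0 :: 'c)" for \<tau>
    proof -
      have "{e. e \<in> arcs ?Y \<and> tail ?Y e = (vs ! i, int \<sigma>) \<and> head ?Y e = (vs ! j, int \<tau>)} =
          (\<lambda>e. (e, int \<sigma>)) ` {e \<in> E. nat ((int \<sigma> + \<alpha> e) mod int n) = \<tau>}"
        using ij n by (auto simp: cyclic_cover_simps[OF n] E_def)
      then have "card {e. e \<in> arcs ?Y \<and> tail ?Y e = (vs ! i, int \<sigma>) \<and> head ?Y e = (vs ! j, int \<tau>)} =
          card {e \<in> E. nat ((int \<sigma> + \<alpha> e) mod int n) = \<tau>}"
        by (simp add: card_image inj_on_def)
      then show ?thesis using finE by (simp add: sum.If_cases Int_def)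
    qed
    have Lac: "?L $$ (a, c) = (if a = c then of_nat (card {e \<in> arcs X. tail X e = vs ! i}) else 0) -
        (\<Sum>e | e \<in> arcs ?Y \<and> tail ?Y e = (vs ! i, int \<sigma>) \<and> head ?Y e = (vs ! (c mod ?g), int (c div ?g)). 1)"
      if "c < ?N" for c
      using that ab deg by (cases "a = c") (auto simp: twisted_laplacian_def len ws i_def \<sigma>_def)
    have "(?L * F) $$ (a, b) = (\<Sum>c<?N. ?L $$ (a, c) * F $$ (c, b))"
      using ab L carrier by (auto simp: scalar_prod_def lessThan_atLeast0 intro!: sum.cong)
    also have "\<dots> = (\<Sum>c<?N. if c mod ?g = j then
        ((if \<sigma> = c div ?g \<and> i = j then of_nat (card {e \<in> arcs X. tail X e = vs ! i}) else 0) -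
        (\<Sum>e\<in>E. if nat ((int \<sigma> + \<alpha> e) mod int n) = c div ?g then 1 else 0)) * z k ^ (c div ?g) else 0)"
    proof (intro sum.cong refl)
      fix c assume "c \<in> {..<?N}"
      then have c: "c < ?N" by simp
      show "?L $$ (a, c) * F $$ (c, b) = (if c mod ?g = j then
        ((if \<sigma> = c div ?g \<and> i = j then of_nat (card {e \<in> arcs X. tail X e = vs ! i}) else 0) -
        (\<Sum>e\<in>E. if nat ((int \<sigma> + \<alpha> e) mod int n) = c div ?g then 1 else 0)) * z k ^ (c div ?g) else 0)"
      proof (cases "c mod ?g = j")
        case True
        then have "a = c \<longleftrightarrow> \<sigma> = c div ?g \<and> i = j"
          using dm_eq[of a c] by (auto simp: i_def \<sigma>_def)
        then show ?thesis
          unfolding Lac[OF c] using True edges[of "c div ?g"] c ab by (simp add: F_def j_def k_def)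
      qed (use c ab in \<open>simp add: F_def j_def\<close>)
    qed
    also have "\<dots> = (\<Sum>\<tau><n. \<Sum>l<?g. if l = j then
        ((if \<sigma> = \<tau> \<and> i = j then of_nat (card {e \<in> arcs X. tail X e = vs ! i}) else 0) -
        (\<Sum>e\<in>E. if nat ((int \<sigma> + \<alpha> e) mod int n) = \<tau> then 1 else 0)) * z k ^ \<tau> else 0)"
      by (rule sum_div_mod[of "\<lambda>\<tau> l. if l = j then
        ((if \<sigma> = \<tau> \<and> i = j then of_nat (card {e \<in> arcs X. tail X e = vs ! i}) else 0) -
        (\<Sum>e\<in>E. if nat ((int \<sigma> + \<alpha> e) mod int n) = \<tau> then 1 else 0)) * z k ^ \<tau> else 0"])
    also have "\<dots> = (\<Sum>\<tau><n.
        ((if \<sigma> = \<tau> \<and> i = j then of_nat (card {e \<in> arcs X. tail X e = vs ! i}) else 0) -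
        (\<Sum>e\<in>E. if nat ((int \<sigma> + \<alpha> e) mod int n) = \<tau> then 1 else 0)) * z k ^ \<tau>)"
      using ij by simp
    also have "\<dots> = (\<Sum>\<tau><n. if \<sigma> = \<tau> then (if i = j then of_nat (card {e \<in> arcs X. tail X e = vs ! i}) else 0) * z k ^ \<tau> else 0) -
        (\<Sum>\<tau><n. \<Sum>e\<in>E. if nat ((int \<sigma> + \<alpha> e) mod int n) = \<tau> then z k ^ \<tau> else 0)"
      unfolding sum_subtractf[symmetric]
      by (intro sum.cong refl) (auto simp: left_diff_distrib sum_distrib_right intro!: sum.cong)
    also have "(\<Sum>\<tau><n. \<Sum>e\<in>E. if nat ((int \<sigma> + \<alpha> e) mod int n) = \<tau> then z k ^ \<tau> else 0) =
        (\<Sum>e\<in>E. \<Sum>\<tau><n. if nat ((int \<sigma> + \<alpha> e) mod int n) = \<tau> then z k ^ \<tau> else 0)"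
      by (rule sum.swap)
    \<comment> \<open>For a fixed arc exactly one sheet \<open>\<tau>\<close> contributes, and the
      reduction mod n of its index disappears because z_k^n = 1.\<close>
    also have "\<dots> = (\<Sum>e\<in>E. z k ^ \<sigma> * z k powi \<alpha> e)"
    proof (intro sum.cong refl)
      fix e
      have "0 \<le> (int \<sigma> + \<alpha> e) mod int n" "(int \<sigma> + \<alpha> e) mod int n < int n" using n by auto
      then have "(\<Sum>\<tau><n. if nat ((int \<sigma> + \<alpha> e) mod int n) = \<tau> then z k ^ \<tau> else 0) =
          z k powi ((int \<sigma> + \<alpha> e) mod int n)"
        by (simp add: power_int_nonneg_exp nat_less_iff)
      also have "\<dots> = z k powi (int \<sigma> + \<alpha> e)"
        by (rule power_int_mod_exponent[OF z(2) n])
      finally show "(\<Sum>\<tau><n. if nat ((int \<sigma> + \<alpha> e) mod int n) = \<tau> then z k ^ \<tau> else 0) =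
          z k ^ \<sigma> * z k powi \<alpha> e"
        using z0[of k] by (simp add: power_int_add)
    qed
    also have "(\<Sum>\<tau><n. if \<sigma> = \<tau> then (if i = j then of_nat (card {e \<in> arcs X. tail X e = vs ! i}) else 0) * z k ^ \<tau> else 0) =
       (if i = j then of_nat (card {e \<in> arcs X. tail X e = vs ! i}) else 0) * z k ^ \<sigma>"
      using ij by simp
    also have "(if i = j then of_nat (card {e \<in> arcs X. tail X e = vs ! i}) else 0) * z k ^ \<sigma> -
        (\<Sum>e\<in>E. z k ^ \<sigma> * z k powi \<alpha> e) = z k ^ \<sigma> * ?B k $$ (i, j)"
      using ij by (simp add: twisted_laplacian_def E_def right_diff_distrib sum_distrib_left mult.commute)
    finally have lhs: "(?L * F) $$ (a, b) = z k ^ \<sigma> * ?B k $$ (i, j)" .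
    have "(F * ?D) $$ (a, b) = (\<Sum>c<?N. F $$ (a, c) * ?D $$ (c, b))"
      using ab carrier by (auto simp: scalar_prod_def lessThan_atLeast0 intro!: sum.cong)
    also have "\<dots> = (\<Sum>c<?N. if i = c mod ?g \<and> c div ?g = k then z (c div ?g) ^ \<sigma> * ?B (c div ?g) $$ (c mod ?g, j) else 0)"
      using ab by (intro sum.cong refl) (auto simp: F_def block_diag_def i_def j_def \<sigma>_def k_def)
    also have "\<dots> = (\<Sum>\<tau><n. \<Sum>l<?g. if i = l \<and> \<tau> = k then z \<tau> ^ \<sigma> * ?B \<tau> $$ (l, j) else 0)"
      by (rule sum_div_mod[of "\<lambda>\<tau> l. if i = l \<and> \<tau> = k then z \<tau> ^ \<sigma> * ?B \<tau> $$ (l, j) else 0"])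
    also have "\<dots> = (\<Sum>\<tau><n. if \<tau> = k then z \<tau> ^ \<sigma> * ?B \<tau> $$ (i, j) else 0)"
      using ij by (intro sum.cong refl) (auto simp: if_distrib cong: if_cong)
    also have "\<dots> = z k ^ \<sigma> * ?B k $$ (i, j)"
      using ij by simp
    finally show "(?L * F) $$ (a, b) = (F * ?D) $$ (a, b)" using lhs by simp
  qed (use L carrier in auto)
  then have "?L * F * F' = F * ?D * F'" by simp
  ultimately have "?L = F * ?D * F'"
    using L carrier by (simp add: assoc_mult_mat[of _ ?N ?N _ ?N _ ?N])
  with \<open>F' * F = _\<close> \<open>F * F' = _\<close> have "similar_mat_wit ?L ?D F F'"
    by (intro similar_mat_witI[OF _ _ _ L carrier(3,1,2)])
  then show ?thesis by (auto simp: similar_mat_def)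
qed

section \<open>Kernels and symmetry of twisted Laplacians\<close>

context fin_digraph
begin

text \<open>The matrix acts on functions on the vertices as a twisted difference operator. Since
  \<open>vs\<close> lists every vertex exactly once, the sum over columns and arcs collapses to the
  actual heads.\<close>

lemma twisted_laplacian_mult_vec:
  fixes w :: "'b \<Rightarrow> 'c :: comm_ring_1"
  assumes vs: "distinct vs" "set vs = verts G" and i: "i < length vs"
  shows "(twisted_laplacian G w vs *\<^sub>v vec (length vs) (\<lambda>j. x (vs ! j))) $ i =
    (\<Sum>e\<in>out_arcs G (vs ! i). x (tail G e) - w e * x (head G e))"
proof -
  let ?g = "length vs"
  define S where "S = {e \<in> arcs G. tail G e = vs ! i}"
  have S: "out_arcs G (vs ! i) = S" and fin: "finite S" by (auto simp: S_def)
  have bij: "bij_betw ((!) vs) {0..<?g} (set vs)"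
    using vs(1) by (intro bij_betw_nth) auto
  have edges: "(\<Sum>e | e \<in> arcs G \<and> tail G e = vs ! i \<and> head G e = v. w e) * x v =
      (\<Sum>e\<in>S. if head G e = v then w e * x (head G e) else 0)" for v
  proof -
    have "{e. e \<in> arcs G \<and> tail G e = vs ! i \<and> head G e = v} = {e \<in> S. head G e = v}"
      by (auto simp: S_def)
    then show ?thesis
      using fin by (simp add: sum_distrib_right sum.inter_filter[symmetric])
  qed
  have "(twisted_laplacian G w vs *\<^sub>v vec ?g (\<lambda>j. x (vs ! j))) $ i =
      (\<Sum>j=0..<?g. (if i = j then of_nat (card S) * x (vs ! j) else 0) -
        (\<Sum>e | e \<in> arcs G \<and> tail G e = vs ! i \<and> head G e = vs ! j. w e) * x (vs ! j))"
    using i by (auto simp: twisted_laplacian_def scalar_prod_def S_def left_diff_distrib intro!: sum.cong)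
  also have "\<dots> = of_nat (card S) * x (vs ! i) -
      (\<Sum>j=0..<?g. \<Sum>e\<in>S. if head G e = vs ! j then w e * x (head G e) else 0)"
    using i by (simp add: sum_subtractf edges)
  also have "(\<Sum>j=0..<?g. \<Sum>e\<in>S. if head G e = vs ! j then w e * x (head G e) else 0) =
      (\<Sum>v\<in>set vs. \<Sum>e\<in>S. if head G e = v then w e * x (head G e) else 0)"
    by (rule sum.reindex_bij_betw[OF bij])
  also have "\<dots> = (\<Sum>e\<in>S. \<Sum>v\<in>set vs. if head G e = v then w e * x (head G e) else 0)"
    by (rule sum.swap)
  also have "\<dots> = (\<Sum>e\<in>S. w e * x (head G e))"
    by (intro sum.cong) (auto simp: S_def vs(2))
  also have "of_nat (card S) * x (vs ! i) = (\<Sum>e\<in>S. x (tail G e))"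
    by (simp add: S_def)
  finally show ?thesis by (simp add: S sum_subtractf)
qed

text \<open>The constant function 1 is in the kernel, and it is a nonzero vector as there is a
  vertex.\<close>

lemma det_laplacian_eq_0:
  assumes vs: "distinct vs" "set vs = verts G" and ne: "verts G \<noteq> {}"
  shows "det (twisted_laplacian G (\<lambda>_. 1) vs) = (0 :: 'c :: idom)"
proof -
  let ?L = "twisted_laplacian G (\<lambda>_. 1) vs :: 'c mat"
  let ?u = "vec (length vs) (\<lambda>j. 1) :: 'c vec"
  have "?L *\<^sub>v ?u = 0\<^sub>v (length vs)"
  proof (rule eq_vecI)
    fix i assume "i < dim_vec (0\<^sub>v (length vs) :: 'c vec)"
    then show "(?L *\<^sub>v ?u) $ i = 0\<^sub>v (length vs) $ i"
      using twisted_laplacian_mult_vec[OF vs, of i "\<lambda>_. 1" "\<lambda>_. 1 :: 'c"] by simp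
  qed (simp add: twisted_laplacian_def)
  moreover have "?u \<noteq> 0\<^sub>v (length vs)"
  proof
    have pos: "0 < length vs" using vs(2) ne by auto
    assume "?u = 0\<^sub>v (length vs)"
    from arg_cong[OF this, of "\<lambda>v. v $ 0"] pos show False by simp
  qed
  ultimately show ?thesis
    by (subst det_0_iff_vec_prod_zero[of _ "length vs"]) (auto intro!: exI[of _ ?u])
qed

end

text \<open>The characteristic polynomial upstairs is \<open>p * q\<close>, with \<open>p\<close>
  belonging to the trivial root z_0 = 1. Since p(0) = 0, the product rule leaves only q(0) p'(0) as
  linear coefficient.\<close>

lemma num_spanning_trees_cyclic_cover:
  fixes z :: "nat \<Rightarrow> 'c :: field_char_0"
  assumes X: "bidirected_digraph X r" "fin_digraph X" and ne: "verts X \<noteq> {}"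
    and \<alpha>: "voltage_assignment X r integer_group \<alpha>"
    and vs: "distinct vs" "set vs = verts X" and n: "n > 0"
    and z: "inj_on z {..<n}" "\<And>k. z k ^ n = 1" "z 0 = 1"
  shows "of_nat n * of_nat (num_spanning_trees (cyclic_cover X \<alpha> n)
      (derived_inversion X r (integer_mod_group n) (\<lambda>a. \<alpha> a mod int n))) =
    of_nat (num_spanning_trees X r) *
      (\<Prod>k=1..<n. det (twisted_laplacian X (\<lambda>e. z k powi \<alpha> e) vs))"
proof -
  let ?Y = "cyclic_cover X \<alpha> n"
  let ?ws = "cyclic_cover_verts vs n"
  let ?g = "length vs"
  let ?B = "\<lambda>k. twisted_laplacian X (\<lambda>e. z k powi \<alpha> e) vs"
  let ?\<kappa> = "of_nat (num_spanning_trees X r) :: 'c"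
  let ?\<kappa>n = "of_nat (num_spanning_trees ?Y
    (derived_inversion X r (integer_mod_group n) (\<lambda>a. \<alpha> a mod int n))) :: 'c"
  define p where "p = char_poly (twisted_laplacian X (\<lambda>_. 1) vs :: 'c mat)"
  define q where "q = (\<Prod>k=1..<n. char_poly (?B k))"
  have g: "?g > 0" using vs(2) ne by auto
  have wset: "set ?ws = verts ?Y" using n vs by (simp add: set_cyclic_cover_verts cyclic_cover_simps)
  have len: "length ?ws = n * ?g" by (simp add: cyclic_cover_verts_def)
  have "char_poly (twisted_laplacian ?Y (\<lambda>_. 1) ?ws) = char_poly (block_diag ?g n ?B)"
    by (rule char_poly_similar[OF similar_laplacian_cyclic_cover[OF X(2) vs(1) n z(1,2)]])
  also have "\<dots> = (\<Prod>k<n. char_poly (?B k))"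
    using g by (intro char_poly_block_diag) auto
  also have "\<dots> = p * q"
    using n z(3) by (simp add: p_def q_def lessThan_atLeast0 prod.atLeast_Suc_lessThan)
  finally have "poly (pderiv (char_poly (twisted_laplacian ?Y (\<lambda>_. 1) ?ws))) 0 =
      poly p 0 * poly (pderiv q) 0 + poly q 0 * poly (pderiv p) 0"
    by (simp add: pderiv_mult)
  also have "poly p 0 = 0"
    unfolding p_def using fin_digraph.det_laplacian_eq_0[OF X(2) vs ne, where 'c = 'c]
    by (simp add: poly_char_poly_0[OF twisted_laplacian_carrier])
  also have "poly (pderiv p) 0 = (-1) ^ (?g - 1) * of_nat ?g * ?\<kappa>"
    unfolding p_def by (rule pderiv_char_poly_laplacian[OF X vs])
  also have "poly q 0 = (\<Prod>k=1..<n. (-1) ^ ?g * det (?B k))"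
    unfolding q_def poly_prod by (intro prod.cong refl poly_char_poly_0 twisted_laplacian_carrier)
  also have "\<dots> = ((-1) ^ ?g) ^ (n - 1) * (\<Prod>k=1..<n. det (?B k))"
    by (simp add: prod.distrib)
  also have "poly (pderiv (char_poly (twisted_laplacian ?Y (\<lambda>_. 1) ?ws))) 0 =
      (-1) ^ (n * ?g - 1) * of_nat (n * ?g) * ?\<kappa>n"
    using pderiv_char_poly_laplacian[OF bidirected_cyclic_cover[OF X(1) \<alpha>]
        fin_digraph_cyclic_cover[OF X(2) n] distinct_cyclic_cover_verts[OF vs(1)] wset]
    unfolding len by blast
  \<comment> \<open>With this splitting the signs on both sides agree and cancel together with the
    factor \<open>length vs\<close>.\<close>
  also have "n * ?g - 1 = (?g - 1) + ?g * (n - 1)"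
    using n g by (cases n; cases ?g) (simp_all add: algebra_simps)
  finally have "((-1) ^ (?g - 1) * (-1) ^ (?g * (n - 1)) * of_nat ?g) * (of_nat n * ?\<kappa>n) =
      ((-1) ^ (?g - 1) * (-1) ^ (?g * (n - 1)) * of_nat ?g) * (?\<kappa> * (\<Prod>k=1..<n. det (?B k)))"
    by (simp add: power_add power_mult mult_ac)
  moreover have "(-1) ^ (?g - 1) * (-1) ^ (?g * (n - 1)) * of_nat ?g \<noteq> (0 :: 'c)"
    using g by simp
  ultimately show ?thesis
    using mult_left_cancel by blast
qed

text \<open>Inversion of arcs exchanges tail and head and negates the voltage, so replacing z by 1/z
  transposes the matrix.\<close>

lemma det_twisted_laplacian_inverse:
  fixes z :: "'c :: field"
  assumes X: "bidirected_digraph X r" and \<alpha>: "voltage_assignment X r integer_group \<alpha>"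
  shows "det (twisted_laplacian X (\<lambda>e. inverse z powi \<alpha> e) vs) = det (twisted_laplacian X (\<lambda>e. z powi \<alpha> e) vs)"
proof -
  interpret bidirected_digraph X r by fact
  let ?L = "\<lambda>z. twisted_laplacian X (\<lambda>e. z powi \<alpha> e) vs"
  have \<alpha>r: "\<alpha> (r e) = - \<alpha> e" if "e \<in> arcs X" for e
    using \<alpha> that by (auto simp: voltage_assignment_def)
  have "?L (inverse z) = transpose_mat (?L z)"
  proof (rule eq_matI)
    fix i j assume "i < dim_row (transpose_mat (?L z))" "j < dim_col (transpose_mat (?L z))"
    then have ij: "i < length vs" "j < length vs" by (auto simp: twisted_laplacian_def)
    let ?E = "\<lambda>i j. {e. e \<in> arcs X \<and> tail X e = vs ! i \<and> head X e = vs ! j}"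
    have "(\<Sum>e\<in>?E i j. inverse z powi \<alpha> e) = (\<Sum>e\<in>?E i j. z powi \<alpha> (r e))"
      by (intro sum.cong refl) (auto simp: \<alpha>r power_int_minus power_int_inverse)
    also have "\<dots> = (\<Sum>e\<in>?E j i. z powi \<alpha> e)"
      by (rule sum.reindex_bij_witness[of _ r r]) auto
    finally show "?L (inverse z) $$ (i, j) = transpose_mat (?L z) $$ (i, j)"
      using ij by (simp add: twisted_laplacian_def)
  qed (auto simp: twisted_laplacian_def)
  then show ?thesis
    by (simp add: det_transpose[OF twisted_laplacian_carrier])
qed

text \<open>
  On a kernel vector \<open>x\<close> of \<open>D - A(-1)\<close> the Dirichlet form
  \<open>\<Sum>\<^sub>e (x (tail e) - (-1)\<^bsup>\<alpha> e\<^esup> x (head e))\<^sup>2\<close> vanishes, so \<open>(v, \<sigma>) \<mapsto> (-1)\<^sup>\<sigma> x v\<close> is constant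
  along the arcs of the connected covering graph; but it changes sign from \<open>(v, 0)\<close> to \<open>(v, 1)\<close>.
\<close>

lemma det_twisted_laplacian_minus_one:
  assumes X: "bidirected_digraph X r" "fin_digraph X"
    and \<alpha>: "voltage_assignment X r integer_group \<alpha>"
    and conn: "strongly_connected (derived_graph X integer_group \<alpha>)"
    and vs: "distinct vs" "set vs = verts X"
  shows "det (twisted_laplacian X (\<lambda>e. (-1) powi \<alpha> e) vs) \<noteq> (0 :: 'c :: linordered_field)"
proof
  interpret bidirected_digraph X r by fact
  interpret fin_digraph X by fact
  let ?g = "length vs"
  let ?L = "twisted_laplacian X (\<lambda>e. (-1) powi \<alpha> e) vs :: 'c mat"
  let ?Z = "derived_graph X integer_group \<alpha>"
  assume "det ?L = 0"
  then obtain v where v: "v \<in> carrier_vec ?g" "v \<noteq> 0\<^sub>v ?g" "?L *\<^sub>v v = 0\<^sub>v ?g"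
    by (subst (asm) det_0_iff_vec_prod_zero[of _ ?g]) auto
  define idx where "idx = the_inv_into {0..<?g} ((!) vs)"
  have bij: "bij_betw ((!) vs) {0..<?g} (set vs)"
    using vs(1) by (intro bij_betw_nth) auto
  have idx: "idx (vs ! i) = i" if "i < ?g" for i
    using bij that unfolding idx_def bij_betw_def by (intro the_inv_into_f_f) auto
  define x where "x u = v $ idx u" for u
  have v_eq: "v = vec ?g (\<lambda>j. x (vs ! j))"
    using v(1) by (intro eq_vecI) (auto simp: x_def idx)
  define s :: "'b \<Rightarrow> 'c" where "s e = (-1) powi \<alpha> e" for e
  have s2: "s e * s e = 1" for e
    by (simp add: s_def flip: power_int_mult_distrib)
  have sr: "s (r e) = s e" if "e \<in> arcs X" for e
  proof -
    have "\<alpha> (r e) = - \<alpha> e" using \<alpha> that by (auto simp: voltage_assignment_def)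
    then have "s (r e) * s e = 1" by (simp add: s_def flip: power_int_add)
    then show ?thesis using s2[of e] by (metis mult.assoc mult.commute mult_1)
  qed
  have harm: "(\<Sum>e\<in>out_arcs X u. x (tail X e) - s e * x (head X e)) = 0" if u: "u \<in> verts X" for u
  proof -
    obtain i where i: "i < ?g" "u = vs ! i" using u vs(2) by (metis in_set_conv_nth)
    have "(?L *\<^sub>v v) $ i = 0" using v(3) i by simp
    then show ?thesis
      using twisted_laplacian_mult_vec[OF vs i(1), of "\<lambda>e. (-1) powi \<alpha> e" x] i v_eq by (simp add: s_def)
  qed
  have out: "out_arcs X u = {e \<in> arcs X. tail X e = u}" for u by auto
  \<comment> \<open>Pairs the kernel equation with \<open>x\<close>, giving a sum over all arcs
    grouped by tails. Reindexing by \<open>r\<close> gives its twin with tail and head exchanged; as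
    s(e)^2 = 1, the two add up to the Dirichlet form.\<close>
  have "0 = (\<Sum>u\<in>verts X. x u * (\<Sum>e\<in>out_arcs X u. x (tail X e) - s e * x (head X e)))"
    by (intro sum.neutral[symmetric] ballI) (simp only: harm mult_zero_right)
  also have "\<dots> = (\<Sum>u\<in>verts X. \<Sum>e\<in>{e \<in> arcs X. tail X e = u}. x (tail X e) * (x (tail X e) - s e * x (head X e)))"
    unfolding out by (intro sum.cong refl) (auto simp: sum_distrib_left intro!: sum.cong)
  also have "\<dots> = (\<Sum>e\<in>arcs X. x (tail X e) * (x (tail X e) - s e * x (head X e)))"
    by (rule sum.group) auto
  finally have A: "(\<Sum>e\<in>arcs X. x (tail X e) * (x (tail X e) - s e * x (head X e))) = 0" by simp
  have "(\<Sum>e\<in>arcs X. x (head X e) * (x (head X e) - s e * x (tail X e))) =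
      (\<Sum>e\<in>arcs X. x (tail X e) * (x (tail X e) - s e * x (head X e)))"
    by (rule sum.reindex_bij_witness[of _ r r]) (auto simp: sr)
  with A have B: "(\<Sum>e\<in>arcs X. x (head X e) * (x (head X e) - s e * x (tail X e))) = 0" by simp
  have "(\<Sum>e\<in>arcs X. (x (tail X e) - s e * x (head X e)) ^ 2) =
     (\<Sum>e\<in>arcs X. x (tail X e) * (x (tail X e) - s e * x (head X e)) +
       x (head X e) * (x (head X e) - s e * x (tail X e)))"
  proof (intro sum.cong refl)
    fix e
    have "(x (tail X e) - s e * x (head X e)) ^ 2 = x (tail X e) * x (tail X e)
        - 2 * s e * x (tail X e) * x (head X e) + (s e * s e) * (x (head X e) * x (head X e))"
      by (simp add: power2_eq_square algebra_simps)
    then show "(x (tail X e) - s e * x (head X e)) ^ 2 = x (tail X e) * (x (tail X e) - s e * x (head X e)) +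
       x (head X e) * (x (head X e) - s e * x (tail X e))"
      unfolding s2 by (simp add: algebra_simps)
  qed
  also have "\<dots> = 0" using A B by (simp add: sum.distrib)
  \<comment> \<open>The order of the field enters here: a sum of squares vanishes only
    termwise.\<close>
  finally have edge: "x (tail X e) = s e * x (head X e)" if "e \<in> arcs X" for e
    using that by (subst (asm) sum_nonneg_eq_0_iff) auto
  define y where "y = (\<lambda>(u, \<sigma>). (-1) powi \<sigma> * x u)"
  have y_arc: "y b = y a" if ab: "(a, b) \<in> arcs_ends ?Z" for a b
  proof -
    obtain e \<sigma> where e: "e \<in> arcs X" "a = (tail X e, \<sigma>)" "b = (head X e, \<sigma> + \<alpha> e)"
      using ab by (auto simp: arcs_ends_def arc_to_ends_def derived_graph_def)
    have "y a = (-1) powi \<sigma> * (s e * x (head X e))" using edge[OF e(1)] by (simp add: y_def e)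
    also have "\<dots> = y b" by (simp add: y_def e s_def power_int_add)
    finally show ?thesis ..
  qed
  have y_reach: "y b = y a" if "a \<rightarrow>\<^sup>*\<^bsub>?Z\<^esub> b" for a b
    using reachable_rtranclI[OF that] by (induction rule: rtrancl_induct) (auto simp: y_arc)
  have x0: "x u = 0" if u: "u \<in> verts X" for u
  proof -
    have "(u, 0) \<in> verts ?Z" "(u, 1) \<in> verts ?Z"
      using u by (auto simp: derived_graph_def)
    then have "y (u, 1) = y (u, 0)"
      using conn y_reach unfolding strongly_connected_def by blast
    then show ?thesis by (simp add: y_def)
  qed
  have "v = 0\<^sub>v ?g"
    unfolding v_eq by (intro eq_vecI) (auto simp: x0 vs(2)[symmetric])
  with v(2) show False by simp
qed

subsection \<open>The Ihara polynomial\<close>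

lemma lp_of_poly_hom: "comm_ring_hom lp_of_poly"
  by unfold_locales
    (simp_all add: lp_of_poly_def of_int_poly_hom.hom_mult of_int_poly_hom.hom_add)

lemma of_int_poly_eval_hom: "comm_ring_hom (\<lambda>p. poly (map_poly of_int p) (z :: 'a :: comm_ring_1))"
  by unfold_locales (simp_all add: of_int_poly_hom.hom_mult of_int_poly_hom.hom_add)

lemma (in comm_ring_hom) hom_of_nat: "hom (of_nat n) = of_nat n"
  by (induction n) (simp_all add: hom_add)

text \<open>The matrix \<open>t\<^sup>N (D - A(t))\<close>, whose entries are polynomials once \<open>N\<close> bounds all voltages.\<close>

definition cleared_ihara_matrix ::
    "('v, 'e) pre_digraph \<Rightarrow> ('e \<Rightarrow> int) \<Rightarrow> nat \<Rightarrow> 'v list \<Rightarrow> int poly mat" where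
  "cleared_ihara_matrix X \<alpha> N vs = mat (length vs) (length vs) (\<lambda>(i, j).
     (if i = j then of_nat (card {e \<in> arcs X. tail X e = vs ! i}) * monom 1 N else 0) -
     (\<Sum>e | e \<in> arcs X \<and> tail X e = vs ! i \<and> head X e = vs ! j. monom 1 (nat (int N + \<alpha> e))))"

text \<open>Under \<open>h\<close> every entry acquires the common factor h(t^N), which leaves the
  determinant once per row. The two instances are the embedding into Laurent polynomials and
  evaluation at a nonzero point; through them one integer polynomial represents both I and the
  numbers det (D - A(z)).\<close>

lemma cleared_ihara_matrix_hom:
  fixes h :: "int poly \<Rightarrow> 'a :: comm_ring_1"
  assumes "comm_ring_hom h"
    and "\<And>e. e \<in> arcs X \<Longrightarrow> h (monom 1 (nat (int N + \<alpha> e))) = h (monom 1 N) * w e"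
  shows "h (det (cleared_ihara_matrix X \<alpha> N vs)) =
    h (monom 1 N) ^ length vs * det (twisted_laplacian X w vs)"
proof -
  interpret comm_ring_hom h by fact
  have "map_mat h (cleared_ihara_matrix X \<alpha> N vs) = h (monom 1 N) \<cdot>\<^sub>m twisted_laplacian X w vs"
  proof (rule eq_matI)
    fix i j
    assume "i < dim_row (h (monom 1 N) \<cdot>\<^sub>m twisted_laplacian X w vs)"
      "j < dim_col (h (monom 1 N) \<cdot>\<^sub>m twisted_laplacian X w vs)"
    then have ij: "i < length vs" "j < length vs" by (auto simp: twisted_laplacian_def)
    have "(\<Sum>e | e \<in> arcs X \<and> tail X e = vs ! i \<and> head X e = vs ! j. h (monom 1 (nat (int N + \<alpha> e)))) =
        h (monom 1 N) * (\<Sum>e | e \<in> arcs X \<and> tail X e = vs ! i \<and> head X e = vs ! j. w e)"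
      unfolding sum_distrib_left by (intro sum.cong) (auto simp: assms(2))
    then show "map_mat h (cleared_ihara_matrix X \<alpha> N vs) $$ (i, j) =
        (h (monom 1 N) \<cdot>\<^sub>m twisted_laplacian X w vs) $$ (i, j)"
      using ij
      by (simp add: cleared_ihara_matrix_def twisted_laplacian_def hom_minus hom_sum hom_mult hom_of_nat
          right_diff_distrib mult.commute)
  qed (auto simp: cleared_ihara_matrix_def twisted_laplacian_def)
  then have "det (map_mat h (cleared_ihara_matrix X \<alpha> N vs)) =
      h (monom 1 N) ^ length vs * det (twisted_laplacian X w vs)"
    by (simp add: twisted_laplacian_def)
  then show ?thesis by (simp add: hom_det)
qed

lemma ihara_poly_eq_twisted_laplacian:
  "ihara_poly X \<alpha> vs = det (twisted_laplacian X (\<lambda>e. lp_power (\<alpha> e)) vs)"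
  by (simp add: ihara_poly_def ihara_matrix_def twisted_laplacian_def)

lemma lp_of_poly_det_cleared_ihara_matrix:
  assumes "\<And>e. e \<in> arcs X \<Longrightarrow> - int N \<le> \<alpha> e"
  shows "lp_of_poly (det (cleared_ihara_matrix X \<alpha> N vs)) =
    lp_power (int (N * length vs)) * ihara_poly X \<alpha> vs"
proof -
  have "lp_of_poly (det (cleared_ihara_matrix X \<alpha> N vs)) =
      lp_of_poly (monom 1 N) ^ length vs * ihara_poly X \<alpha> vs"
    unfolding ihara_poly_eq_twisted_laplacian
    by (rule cleared_ihara_matrix_hom[OF lp_of_poly_hom])
      (use assms in \<open>force simp: lp_of_poly_monom lp_power_add\<close>)
  also have "lp_of_poly (monom 1 N) ^ length vs = lp_power (int (N * length vs))"
    by (simp add: lp_of_poly_monom lp_power_of_nat[of N] lp_power_of_nat[of "N * length vs"] power_mult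
        del: of_nat_mult)
  finally show ?thesis .
qed

lemma poly_det_cleared_ihara_matrix:
  fixes z :: "'a :: field"
  assumes "\<And>e. e \<in> arcs X \<Longrightarrow> - int N \<le> \<alpha> e" and "z \<noteq> 0"
  shows "poly (map_poly of_int (det (cleared_ihara_matrix X \<alpha> N vs))) z =
    z ^ (N * length vs) * det (twisted_laplacian X (\<lambda>e. z powi \<alpha> e) vs)"
proof -
  have *: "poly (map_poly of_int (monom 1 m)) z = z ^ m" for m
    by (simp add: map_poly_monom poly_monom)
  have "poly (map_poly of_int (det (cleared_ihara_matrix X \<alpha> N vs))) z =
      poly (map_poly of_int (monom 1 N)) z ^ length vs * det (twisted_laplacian X (\<lambda>e. z powi \<alpha> e) vs)"
  proof (rule cleared_ihara_matrix_hom[OF of_int_poly_eval_hom])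
    fix e assume "e \<in> arcs X"
    then have "int N + \<alpha> e \<ge> 0" using assms(1) by force
    then have "z ^ nat (int N + \<alpha> e) = z powi (int N + \<alpha> e)"
      by (simp add: power_int_nonneg_exp)
    also have "\<dots> = z ^ N * z powi \<alpha> e"
      using assms(2) by (simp add: power_int_add)
    finally show "poly (map_poly of_int (monom 1 (nat (int N + \<alpha> e)))) z =
        poly (map_poly of_int (monom 1 N)) z * z powi \<alpha> e"
      by (simp only: *)
  qed
  then show ?thesis by (simp only: * power_mult)
qed

text \<open>
  For \<open>p = t\<^sup>k q\<close>, the hypothesis says that \<open>p / t\<^sup>M\<close> is invariant under \<open>t \<mapsto> 1 / t\<close>.
\<close>

lemma degree_of_self_reciprocal:
  fixes q :: "'a :: field_char_0 poly"
  assumes sym: "\<And>z. z \<noteq> 0 \<Longrightarrow> z ^ k * poly q z = z ^ (2 * M) * (inverse z ^ k * poly q (inverse z))"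
    and q0: "poly q 0 \<noteq> 0"
  shows "2 * k + degree q = 2 * M"
proof -
  define d where "d = degree q"
  \<comment> \<open>Multiplying the hypothesis by z^(k+d) turns q(1/z) into the reflected
    polynomial; the two sides then agree at infinitely many points.\<close>
  have "monom 1 (2 * k + d) * q = monom 1 (2 * M) * reflect_poly q"
  proof (rule ccontr)
    define D where "D = monom 1 (2 * k + d) * q - monom 1 (2 * M) * reflect_poly q"
    assume "monom 1 (2 * k + d) * q \<noteq> monom 1 (2 * M) * reflect_poly q"
    then have "D \<noteq> 0" by (simp add: D_def)
    have "poly D z = 0" if z: "z \<noteq> 0" for z
    proof -
      have "z ^ (2 * k + d) * poly q z = z ^ (k + d) * (z ^ k * poly q z)"
        unfolding mult_2 power_add by (simp only: mult_ac)
      also have "\<dots> = (z ^ k * inverse z ^ k) * (z ^ (2 * M) * (z ^ d * poly q (inverse z)))"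
        unfolding sym[OF z] by (simp add: power_add mult_ac)
      also have "z ^ k * inverse z ^ k = 1"
        using z by (simp flip: power_mult_distrib)
      finally show ?thesis
        by (simp add: D_def poly_monom poly_reflect_poly_nz[OF z] d_def)
    qed
    then have "- {0} \<subseteq> {z. poly D z = 0}" by auto
    then have "finite (- {0 :: 'a})"
      using poly_roots_finite[OF \<open>D \<noteq> 0\<close>] finite_subset by blast
    then have "finite (UNIV :: 'a set)"
      using finite_insert[of 0 "- {0 :: 'a}"] by (simp add: Compl_eq_Diff_UNIV)
    then show False using infinite_UNIV_char_0 by blast
  qed
  then have "degree (monom 1 (2 * k + d) * q) = degree (monom 1 (2 * M) * reflect_poly q)"
    by simp
  \<comment> \<open>Since q(0) is nonzero, reflection preserves the degree, so comparing degrees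
    gives 2 k + 2 d = 2 M + d.\<close>
  moreover have "q \<noteq> 0" "degree (reflect_poly q) = d"
    using q0 by (auto simp: d_def poly_0_coeff_0)
  moreover from this have "reflect_poly q \<noteq> 0" by simp
  ultimately show ?thesis
    by (simp add: degree_mult_eq degree_monom_eq monom_eq_0_iff d_def)
qed

subsection \<open>Roots of unity and Pierce-Lehmer sequences\<close>

definition unity_root :: "nat \<Rightarrow> nat \<Rightarrow> complex" where
  "unity_root n k = cis (2 * pi * real k / real n)"

lemma unity_root_0 [simp]: "unity_root n 0 = 1"
  by (simp add: unity_root_def)

lemma unity_root_nonzero [simp]: "unity_root n k \<noteq> 0"
  by (simp add: unity_root_def)

lemma unity_root_power: "n > 0 \<Longrightarrow> unity_root n k ^ n = 1"
  by (simp add: unity_root_def DeMoivre)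

lemma bij_betw_unity_root: "n > 0 \<Longrightarrow> bij_betw (unity_root n) {..<n} {z. z ^ n = 1}"
  unfolding unity_root_def by (rule bij_betw_roots_unity)

text \<open>Both sides are monic of degree n and vanish at the n distinct n-th roots of
  unity.\<close>

lemma prod_unity_root_poly:
  assumes n: "n > 0"
  shows "(\<Prod>k<n. [:- unity_root n k, 1:]) = monom 1 n - 1"
proof (rule poly_eqI_degree_lead_coeff[where n = n and A = "{z. z ^ n = 1}"])
  have deg: "degree (\<Prod>k<n. [:- unity_root n k, 1:]) = n"
    by (subst degree_prod_eq_sum_degree) auto
  then show "degree (\<Prod>k<n. [:- unity_root n k, 1:]) \<le> n" by simp
  show "degree (monom 1 n - 1 :: complex poly) \<le> n"
    by (intro degree_diff_le degree_monom_le) simp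
  have "coeff (\<Prod>k<n. [:- unity_root n k, 1:]) n = 1"
    using lead_coeff_prod[of "\<lambda>k. [:- unity_root n k, 1:]" "{..<n}"] deg by simp
  then show "coeff (\<Prod>k<n. [:- unity_root n k, 1:]) n = coeff (monom 1 n - 1) n"
    using n by simp
  show "n \<le> card {z :: complex. z ^ n = 1}"
    using card_roots_unity_eq[OF n] by simp
  show "poly (\<Prod>k<n. [:- unity_root n k, 1:]) z = poly (monom 1 n - 1) z" if z: "z \<in> {z. z ^ n = 1}" for z
  proof -
    obtain k where "k < n" "z = unity_root n k"
      using bij_betw_unity_root[OF n] z by (auto simp: bij_betw_def)
    then show ?thesis using z by (auto simp: poly_prod poly_monom)
  qed
qed

lemma power_minus_1_eq_prod: "n > 0 \<Longrightarrow> z ^ n - 1 = (\<Prod>k<n. z - unity_root n k)"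
  using arg_cong[OF prod_unity_root_poly, of n "\<lambda>p. poly p z"]
  by (simp add: poly_prod poly_monom)

lemma prod_nontrivial_unity_roots:
  assumes n: "n > 0"
  shows "(\<Prod>k=1..<n. z - unity_root n k) = (\<Sum>k<n. z ^ k)"
proof -
  have "[:-1, 1:] * (\<Prod>k=1..<n. [:- unity_root n k, 1:]) = (\<Prod>k<n. [:- unity_root n k, 1:])"
    using n by (simp add: lessThan_atLeast0 prod.atLeast_Suc_lessThan)
  also have "\<dots> = monom 1 n - 1" by (rule prod_unity_root_poly[OF n])
  also have "\<dots> = [:-1, 1:] * (\<Sum>k<n. monom 1 k)"
    by (rule poly_ext) (simp add: poly_monom poly_sum power_diff_1_eq algebra_simps)
  finally have "(\<Prod>k=1..<n. [:- unity_root n k, 1:]) = (\<Sum>k<n. monom 1 k)"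
    by (subst (asm) mult_cancel_left) simp
  from arg_cong[OF this, of "\<lambda>p. poly p z"] show ?thesis
    by (simp add: poly_prod poly_sum poly_monom)
qed

text \<open>The preceding identity at z = 0 and at z = 1, where the geometric sum is 1 and n; the
  sign comes from negating n - 1 factors.\<close>

lemma prod_unity_roots:
  assumes "n > 0"
  shows "(\<Prod>k=1..<n. unity_root n k) = (-1) ^ (n - 1)"
    and "(\<Prod>k=1..<n. unity_root n k - 1) = (-1) ^ (n - 1) * of_nat n"
proof -
  have neg: "(\<Prod>k=1..<n. - f k) = (-1) ^ (n - 1) * (\<Prod>k=1..<n. f k)" for f :: "nat \<Rightarrow> complex"
    by (simp add: prod_uminus)
  have "(\<Prod>k=1..<n. unity_root n k) = (-1) ^ (n - 1) * (\<Prod>k=1..<n. 0 - unity_root n k)"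
    using neg[of "\<lambda>k. - unity_root n k"] by simp
  also have "(\<Prod>k=1..<n. 0 - unity_root n k) = (\<Sum>k<n. 0 ^ k)"
    by (rule prod_nontrivial_unity_roots[OF assms])
  also have "\<dots> = 1" using assms by (simp add: power_0_left)
  finally show "(\<Prod>k=1..<n. unity_root n k) = (-1) ^ (n - 1)" by simp
  have "(\<Prod>k=1..<n. unity_root n k - 1) = (-1) ^ (n - 1) * (\<Prod>k=1..<n. 1 - unity_root n k)"
    using neg[of "\<lambda>k. 1 - unity_root n k"] by simp
  then show "(\<Prod>k=1..<n. unity_root n k - 1) = (-1) ^ (n - 1) * of_nat n"
    using prod_nontrivial_unity_roots[OF assms, of 1] by simp
qed

text \<open>The resultant of f and t^n - 1 computed from the other side: factor each z^n - 1 over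
  the roots of unity, exchange the products, and recognise f(zeta) up to one sign per root of
  f.\<close>

lemma pierce_lehmer_eq_prod:
  assumes n: "n > 0"
  shows "pierce_lehmer f n =
    (\<Prod>k<n. (-1) ^ degree f * poly (map_poly of_int f) (unity_root n k))"
proof -
  let ?p = "map_poly of_int f :: complex poly"
  let ?a = "of_int (lead_coeff f) :: complex"
  have lc: "lead_coeff ?p = ?a" and deg: "size (proots ?p) = degree f"
    by (simp_all add: size_proots_complex)
  have eval: "poly ?p w = ?a * (\<Prod>z\<in>#proots ?p. w - z)" for w
    using arg_cong[OF complex_poly_decompose_multiset[of ?p], of "\<lambda>p. poly p w"]
    by (simp add: poly_prod_mset multiset.map_comp o_def lc)
  have swap: "(\<Prod>z\<in>#A. \<Prod>k<n. z - unity_root n k) = (\<Prod>k<n. \<Prod>z\<in>#A. z - unity_root n k)" for A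
    by (induction A) (simp_all add: prod.distrib)
  have neg: "(\<Prod>z\<in>#A. z - w) = (-1) ^ size A * (\<Prod>z\<in>#A. w - z)" for A and w :: complex
    by (induction A) (simp_all add: algebra_simps)
  have "pierce_lehmer f n = ?a ^ n * (\<Prod>k<n. \<Prod>z\<in>#proots ?p. z - unity_root n k)"
    by (simp add: pierce_lehmer_def power_minus_1_eq_prod[OF n] swap)
  also have "\<dots> = (\<Prod>k<n. ?a * (\<Prod>z\<in>#proots ?p. z - unity_root n k))"
    by (simp add: prod.distrib)
  also have "\<dots> = (\<Prod>k<n. (-1) ^ degree f * poly ?p (unity_root n k))"
    by (intro prod.cong refl) (simp only: neg deg eval mult_ac)
  finally show ?thesis .
qed

text \<open>The factor at the trivial root of unity is the value for n = 1, so division removes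
  precisely that factor.\<close>

lemma pierce_lehmer_ratio:
  assumes n: "n > 0" and J: "poly f 1 \<noteq> 0"
  shows "pierce_lehmer f 1 \<noteq> 0"
    and "pierce_lehmer f n / pierce_lehmer f 1 =
      ((-1) ^ (n - 1)) ^ degree f * (\<Prod>k=1..<n. poly (map_poly of_int f) (unity_root n k))"
proof -
  let ?p = "map_poly of_int f :: complex poly"
  have "poly ?p 1 = of_int (poly f 1)"
    using of_int_hom.poly_map_poly[of f 1] by simp
  then have p1: "poly ?p 1 \<noteq> 0" using J by simp
  have PL1: "pierce_lehmer f 1 = (-1) ^ degree f * poly ?p 1"
    by (simp add: pierce_lehmer_eq_prod)
  then show "pierce_lehmer f 1 \<noteq> 0" using p1 by simp
  have "pierce_lehmer f n = (-1) ^ degree f * poly ?p 1 *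
      (\<Prod>k=1..<n. (-1) ^ degree f * poly ?p (unity_root n k))"
    unfolding pierce_lehmer_eq_prod[OF n]
    using n by (simp add: lessThan_atLeast0 prod.atLeast_Suc_lessThan)
  also have "\<dots> = pierce_lehmer f 1 * (((-1) ^ (n - 1)) ^ degree f *
      (\<Prod>k=1..<n. poly ?p (unity_root n k)))"
    unfolding PL1 prod.distrib by (simp flip: power_mult add: mult.commute[of "degree f"])
  finally show "pierce_lehmer f n / pierce_lehmer f 1 =
      ((-1) ^ (n - 1)) ^ degree f * (\<Prod>k=1..<n. poly ?p (unity_root n k))"
    using \<open>pierce_lehmer f 1 \<noteq> 0\<close> by simp
qed

text \<open>J is pinned down by the division-free equation (t - 1)^e J = t^b I among Laurent
  polynomials, and its unique existence is part of the claim. So are I \<noteq> 0, without which the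
  orders would be meaningless, and the nonvanishing of the denominator.\<close>

theorem theorem3p6:
  fixes X :: "('v, 'e) pre_digraph" and r :: "'e \<Rightarrow> 'e"
    and \<alpha> :: "'e \<Rightarrow> int" and vs :: "'v list"
  assumes "bidirected_digraph X r" and "fin_digraph X" and "strongly_connected X"
    and "euler_char X \<noteq> 0"
    and "voltage_assignment X r integer_group \<alpha>"
    and "strongly_connected (derived_graph X integer_group \<alpha>)"
    and "distinct vs" and "set vs = verts X"
  defines "I \<equiv> ihara_poly X \<alpha> vs"
  defines "b \<equiv> - lp_order 0 I" and "e \<equiv> lp_order 1 I"
  shows "I \<noteq> 0 \<and> b \<ge> 0 \<and> e \<ge> 1 \<and>
    (\<exists>!J. (lp_power 1 - 1) ^ nat e * lp_of_poly J = lp_power b * I) \<and>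
    (\<forall>J. (lp_power 1 - 1) ^ nat e * lp_of_poly J = lp_power b * I \<longrightarrow>
      pierce_lehmer J 1 \<noteq> 0 \<and>
      (\<forall>n\<ge>1.
        complex_of_nat (num_spanning_trees
          (derived_graph X (integer_mod_group n) (\<lambda>a. \<alpha> a mod int n))
          (derived_inversion X r (integer_mod_group n) (\<lambda>a. \<alpha> a mod int n)))
        = (-1) powi (b * (int n - 1)) * of_nat (num_spanning_trees X r)
          * of_nat n powi (e - 1) * (pierce_lehmer J n / pierce_lehmer J 1)))"
proof -
  interpret X: fin_digraph X by fact
  have ne: "verts X \<noteq> {}" using assms(3) by (simp add: strongly_connected_def)
  define N where "N = nat (\<Sum>e\<in>arcs X. \<bar>\<alpha> e\<bar>)"
  have N: "- int N \<le> \<alpha> a" if "a \<in> arcs X" for a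
  proof -
    have "\<bar>\<alpha> a\<bar> \<le> (\<Sum>e\<in>arcs X. \<bar>\<alpha> e\<bar>)"
      using that by (intro member_le_sum) auto
    then show ?thesis by (simp add: N_def)
  qed
  define M where "M = N * length vs"
  define P where "P = det (cleared_ihara_matrix X \<alpha> N vs)"
  let ?L = "\<lambda>z :: complex. twisted_laplacian X (\<lambda>a. z powi \<alpha> a) vs"
  have MI: "lp_power (int M) * I = lp_of_poly P"
    unfolding I_def M_def P_def using N by (rule lp_of_poly_det_cleared_ihara_matrix[symmetric])
  have evalP: "poly (map_poly of_int P) z = z ^ M * det (?L z)" if "z \<noteq> 0" for z
    unfolding M_def P_def using N that by (rule poly_det_cleared_ihara_matrix)
  \<comment> \<open>Evaluated over the reals, because the nonvanishing at -1 is available over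
    ordered fields.\<close>
  have "poly (map_poly of_int P) (-1 :: real) =
      (-1) ^ M * det (twisted_laplacian X (\<lambda>a. (-1) powi \<alpha> a) vs)"
    unfolding M_def P_def using N
    by (intro poly_det_cleared_ihara_matrix) auto
  then have P0: "P \<noteq> 0"
    using det_twisted_laplacian_minus_one[OF assms(1,2,5-8), where 'c = real] by auto
  have I0: "I \<noteq> 0"
  proof
    assume "I = 0"
    then have "lp_of_poly P = lp_of_poly 0" using MI by (simp add: lp_of_poly_def)
    then show False using P0 by (simp only: lp_of_poly_inject)
  qed
  \<comment> \<open>These are the exponents in P = t^m (t - 1)^k J. As P = t^M I, they give b = M -
    m and e = k.\<close>
  define m where "m = Polynomial.order 0 P"
  define k where "k = Polynomial.order 1 P"
  have b_eq: "b = int M - int m"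
    using lp_order_eq[OF I0 MI, of 0] by (simp add: b_def m_def)
  have "Polynomial.order (1 :: int) (monom 1 M) = 0"
    by (rule order_0I) (simp add: poly_monom)
  then have e_eq: "e = int k"
    using lp_order_eq[OF I0 MI, of 1] by (simp add: e_def k_def)
  have "poly (map_poly of_int P) (1 :: complex) = of_int (poly P 1)"
    using of_int_hom.poly_map_poly[of P 1] by simp
  moreover have "poly (map_poly of_int P) (1 :: complex) = 0"
    using evalP[of 1] X.det_laplacian_eq_0[OF assms(7,8) ne, where 'c = complex] by simp
  ultimately have "poly P 1 = 0" by simp
  then have k: "k \<ge> 1"
    using P0 by (simp add: order_root k_def Suc_le_eq)
  have lp_cancel: "lp_power i * f = lp_power i * h \<longleftrightarrow> f = h" for i f h
  proof
    assume "lp_power i * f = lp_power i * h"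
    then have "lp_power (- i) * (lp_power i * f) = lp_power (- i) * (lp_power i * h)" by simp
    then show "f = h"
      unfolding mult.assoc[symmetric] lp_power_add[symmetric] by (simp add: lp_power_def)
  qed simp
  \<comment> \<open>Multiplication by the unit t^m turns t^b I into t^M I, the image of P, so the
    equation for J becomes one between ordinary polynomials.\<close>
  have J_iff: "(lp_power 1 - 1) ^ nat e * lp_of_poly J = lp_power b * I \<longleftrightarrow>
      P = monom 1 m * ([:-1, 1:] ^ k * J)" for J
  proof -
    interpret lp: comm_ring_hom lp_of_poly by (rule lp_of_poly_hom)
    have "lp_of_poly [:-1, 1:] = lp_power 1 - 1"
      by (simp add: lp_of_poly_def)
    then have "lp_of_poly (monom 1 m * ([:-1, 1:] ^ k * J)) =
        lp_power (int m) * ((lp_power 1 - 1) ^ nat e * lp_of_poly J)"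
      by (simp add: lp.hom_mult lp.hom_power lp_of_poly_monom e_eq)
    moreover have "lp_of_poly P = lp_power (int m) * (lp_power b * I)"
      unfolding MI[symmetric] by (simp add: b_eq flip: lp_power_add mult.assoc)
    ultimately show ?thesis
      using lp_cancel lp_of_poly_inject by metis
  qed
  obtain J0 where J0: "P = monom 1 m * ([:-1, 1:] ^ k * J0)"
  proof -
    obtain q where q: "P = [:- 0, 1:] ^ m * q"
      using order_decomp[OF P0, of 0] by (auto simp: m_def)
    then have q: "P = monom 1 m * q" by (simp add: monom_altdef)
    have "Polynomial.order 1 (monom 1 m :: int poly) = 0"
      by (rule order_0I) (simp add: poly_monom)
    then have "Polynomial.order 1 q = k"
      using order_mult[of "monom 1 m" q 1] P0 unfolding k_def q by simp
    moreover have "q \<noteq> 0" using P0 q by auto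
    ultimately obtain J where "q = [:-1, 1:] ^ k * J"
      using order_decomp[of q 1] by auto
    with q show ?thesis using that by blast
  qed
  have unique: "J = J0" if "P = monom 1 m * ([:-1, 1:] ^ k * J)" for J
    using that unfolding J0 by (simp add: monom_eq_0_iff)
  have P_factors: "monom 1 m * ([:-1, 1:] ^ k * J0) \<noteq> 0" "[:-1, 1:] ^ k * J0 \<noteq> 0"
    using P0 J0 by auto
  have J1: "poly J0 1 \<noteq> 0"
  proof -
    have "Polynomial.order 1 (monom 1 m :: int poly) = 0"
      by (rule order_0I) (simp add: poly_monom)
    moreover have "Polynomial.order 1 P = Polynomial.order 1 (monom 1 m :: int poly) +
        (Polynomial.order 1 ([:-1, 1:] ^ k :: int poly) + Polynomial.order 1 J0)"
      unfolding J0 order_mult[OF P_factors(1)] order_mult[OF P_factors(2)] by (rule refl)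
    moreover have "Polynomial.order 1 ([:-1, 1:] ^ k :: int poly) = k"
      by (rule order_power_n_n)
    ultimately have "Polynomial.order 1 J0 = 0"
      unfolding k_def[symmetric] by linarith
    then show ?thesis using P_factors by (auto simp: order_root)
  qed
  \<comment> \<open>This is deg J = 2 b - e, obtained from the symmetry of I applied to q = (t -
    1)^k J. Here q(0) is nonzero because t^m already takes up the whole order of P at 0.\<close>
  have deg: "2 * m + (k + degree J0) = 2 * M"
  proof -
    let ?q = "map_poly of_int ([:-1, 1:] ^ k * J0) :: complex poly"
    have Pq: "poly (map_poly of_int P) z = z ^ m * poly ?q z" for z :: complex
      unfolding J0 by (simp add: of_int_poly_hom.hom_mult map_poly_monom poly_monom)
    have "Polynomial.order 0 P = Polynomial.order 0 (monom 1 m :: int poly) +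
        Polynomial.order 0 ([:-1, 1:] ^ k * J0)"
      unfolding J0 by (rule order_mult[OF P_factors(1)])
    then have "Polynomial.order 0 ([:-1, 1:] ^ k * J0) = 0"
      unfolding m_def[symmetric] by simp
    then have "poly ([:-1, 1:] ^ k * J0) 0 \<noteq> 0"
      using P_factors(2) order_root[of "[:-1, 1:] ^ k * J0" 0] by blast
    then have "poly ?q 0 \<noteq> 0"
      using of_int_hom.poly_map_poly[of "[:-1, 1:] ^ k * J0" 0, where 'a = complex] by simp
    moreover have "z ^ m * poly ?q z = z ^ (2 * M) * (inverse z ^ m * poly ?q (inverse z))"
      if z: "z \<noteq> 0" for z
    proof -
      have "inverse z ^ m * poly ?q (inverse z) = inverse z ^ M * det (?L z)"
        using evalP[of "inverse z"] Pq z det_twisted_laplacian_inverse[OF assms(1,5), of z vs] by simp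
      moreover have "z ^ (2 * M) * inverse z ^ M = z ^ M"
        using z by (simp add: mult_2 power_add power_inverse)
      ultimately show ?thesis
        using evalP[OF z] Pq by (simp flip: mult.assoc)
    qed
    ultimately have "2 * m + degree ?q = 2 * M"
      by (intro degree_of_self_reciprocal)
    moreover have "degree ?q = k + degree J0"
      using P_factors by (simp add: degree_mult_eq degree_power_eq)
    ultimately show ?thesis by simp
  qed
  then have mM: "m \<le> M" by simp
  have formula: "complex_of_nat (num_spanning_trees
        (derived_graph X (integer_mod_group n) (\<lambda>a. \<alpha> a mod int n))
        (derived_inversion X r (integer_mod_group n) (\<lambda>a. \<alpha> a mod int n)))
      = (-1) powi (b * (int n - 1)) * of_nat (num_spanning_trees X r)
        * of_nat n powi (e - 1) * (pierce_lehmer J0 n / pierce_lehmer J0 1)"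
    (is "?\<kappa>n = _ * ?\<kappa> * _ * ?\<rho>") if n: "n \<ge> 1" for n
  proof -
    let ?z = "unity_root n"
    let ?J = "map_poly of_int J0 :: complex poly"
    define s :: complex where "s = (-1) ^ (n - 1)"
    have n0: "n > 0" using n by simp
    have s2: "s * s = 1" by (simp add: s_def flip: power_mult_distrib)
    have "of_nat n * ?\<kappa>n = ?\<kappa> * (\<Prod>j=1..<n. det (?L (?z j)))"
      using num_spanning_trees_cyclic_cover[OF assms(1,2) ne assms(5,7,8) n0, of ?z]
        bij_betw_unity_root[OF n0] unity_root_power[OF n0]
      by (simp add: cyclic_cover_def bij_betw_def)
    \<comment> \<open>Two expressions for P(z), multiplied over the nontrivial roots z: the product
      of the z is \<open>s\<close>, that of the z - 1 is \<open>s * of_nat n\<close>.\<close>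
    moreover have "s ^ M * (\<Prod>j=1..<n. det (?L (?z j))) =
        s ^ m * ((s * of_nat n) ^ k * (\<Prod>j=1..<n. poly ?J (?z j)))"
    proof -
      have "?z j ^ M * det (?L (?z j)) = ?z j ^ m * ((?z j - 1) ^ k * poly ?J (?z j))" for j
        using evalP[of "?z j"] unfolding J0
        by (simp add: of_int_poly_hom.hom_mult of_int_poly_hom.hom_power map_poly_monom poly_monom)
      then have "(\<Prod>j=1..<n. ?z j ^ M * det (?L (?z j))) =
          (\<Prod>j=1..<n. ?z j ^ m * ((?z j - 1) ^ k * poly ?J (?z j)))"
        by simp
      then show ?thesis
        unfolding prod.distrib prod_power_distrib[symmetric] prod_unity_roots[OF n0] s_def .
    qed
    moreover have \<rho>: "?\<rho> = s ^ degree J0 * (\<Prod>j=1..<n. poly ?J (?z j))"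
      unfolding s_def by (rule pierce_lehmer_ratio(2)[OF n0 J1])
    ultimately have eq: "s ^ M * s ^ degree J0 * (of_nat n * ?\<kappa>n) = s ^ (m + k) * of_nat n ^ k * ?\<kappa> * ?\<rho>"
      by (simp add: power_add power_mult_distrib mult_ac)
    \<comment> \<open>As e is at least 1, a factor n splits off and cancels the one in front of
      kappa(X_n).\<close>
    have nk: "(of_nat n :: complex) ^ k = of_nat n * of_nat n ^ (k - 1)"
      using k by (cases k) auto
    have "of_nat n * (s ^ (M + degree J0) * ?\<kappa>n) = s ^ M * s ^ degree J0 * (of_nat n * ?\<kappa>n)"
      by (simp only: power_add mult_ac)
    also have "\<dots> = of_nat n * (s ^ (m + k) * of_nat n ^ (k - 1) * ?\<kappa> * ?\<rho>)"
      unfolding eq nk by (simp only: mult_ac)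
    finally have "s ^ (M + degree J0) * ?\<kappa>n = s ^ (m + k) * of_nat n ^ (k - 1) * ?\<kappa> * ?\<rho>"
      using n0 by (subst (asm) mult_cancel_left) simp
    then have "s ^ (M + degree J0) * (s ^ (M + degree J0) * ?\<kappa>n) =
        s ^ (M + degree J0) * (s ^ (m + k) * of_nat n ^ (k - 1) * ?\<kappa> * ?\<rho>)"
      by simp
    moreover have "s ^ (M + degree J0) * s ^ (M + degree J0) = 1"
      by (simp add: s2 flip: power_mult_distrib)
    \<comment> \<open>By the degree formula the total exponent is 3 M - m, and \<open>s\<close>
      squares to 1; what remains is s^b.\<close>
    moreover have "s ^ (M + degree J0) * s ^ (m + k) = s ^ (M - m)"
    proof -
      have "M + degree J0 + (m + k) = 2 * M + (M - m)" using deg mM by linarith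
      then have "s ^ (M + degree J0) * s ^ (m + k) = (s * s) ^ M * s ^ (M - m)"
        by (metis power2_eq_square power_add power_mult)
      then show ?thesis by (simp add: s2)
    qed
    ultimately have "?\<kappa>n = s ^ (M - m) * of_nat n ^ (k - 1) * ?\<kappa> * ?\<rho>"
      by (metis (no_types, lifting) mult.assoc mult_1)
    moreover have "(-1) powi (b * (int n - 1)) = s ^ (M - m)"
    proof -
      have "b * (int n - 1) = int ((n - 1) * (M - m))"
        using n0 mM by (simp add: b_eq of_nat_diff mult.commute)
      then show ?thesis by (simp only: power_int_of_nat power_mult s_def)
    qed
    moreover have "(of_nat n :: complex) powi (e - 1) = of_nat n ^ (k - 1)"
    proof -
      have "e - 1 = int (k - 1)" using k by (simp add: e_eq of_nat_diff)
      then show ?thesis by (simp only: power_int_of_nat)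
    qed
    ultimately show ?thesis by (simp add: mult_ac)
  qed
  have "\<exists>!J. (lp_power 1 - 1) ^ nat e * lp_of_poly J = lp_power b * I"
    unfolding J_iff using J0 unique by blast
  moreover have "pierce_lehmer J0 1 \<noteq> 0"
    using pierce_lehmer_ratio(1)[of 1 J0] J1 by simp
  ultimately show ?thesis
    using I0 b_eq mM e_eq k formula unique unfolding J_iff by auto
qed

end
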